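(* Let $\mathbf{X}=(X_1,\dots,X_n)$ be a vector of independent random variables with values in a space $\mathcal{X}$, let $\mathbf{X}'$ be an independent copy of $\mathbf{X}$, let $\mathcal{U}\subseteq\mathbb{R}^d$, and let $\mathcal{H}$ be a finite class of functions $h:\mathcal{X}\to\mathcal{U}$. For $\mathbf{x}\in\mathcal{X}^n$ write $h(\mathbf{x})=(h(x_1),\dots,h(x_n))\in\mathcal{U}^n$ and $\mathcal{H}(\mathbf{x})=\{h(\mathbf{x}):h\in\mathcal{H}\}\subseteq\mathbb{R}^{dn}$. Let $f:\mathcal{U}^n\to\mathbb{R}$. Then for every $\delta\in(0,1)$, with probability at least $1-\delta$ (in $\mathbf{X}$), $$\sup_{h\in\mathcal{H}}\Big(\mathbb{E}\big[f(h(\mathbf{X}'))\big]-f(h(\mathbf{X}))\Big)\le\sqrt{2\pi}\,\big(2M_{Lip}(f)+J_{Lip}(f)\big)\,\mathbb{E}\big[G(\mathcal{H}(\mathbf{X}'))\big]+M(f)\sqrt{n\ln(1/\delta)}.$$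
   Context: For a set $\mathcal{Z}$, a function $f:\mathcal{Z}^n\to\mathbb{R}$, $k\in\{1,\dots,n\}$ and $y,y'\in\mathcal{Z}$, the $k$-th partial difference operator is $$D^k_{y,y'}f(\mathbf{x})=f(\dots,x_{k-1},y,x_{k+1},\dots)-f(\dots,x_{k-1},y',x_{k+1},\dots),\qquad \mathbf{x}\in\mathcal{Z}^n.$$ For $\mathcal{U}\subseteq\mathbb{R}^d$ and $f:\mathcal{U}^n\to\mathbb{R}$, $$M(f)=\max_k\ \sup_{\mathbf{x}\in\mathcal{U}^n,\ y,y'\in\mathcal{U}}D^k_{y,y'}f(\mathbf{x}),\qquad M_{Lip}(f)=\max_k\ \sup_{\mathbf{x}\in\mathcal{U}^n,\ y\ne y'\in\mathcal{U}}\frac{D^k_{y,y'}f(\mathbf{x})}{\|y-y'\|},$$ $$J_{Lip}(f)=n\max_{k\ne l}\ \sup_{\mathbf{x}\in\mathcal{U}^n,\ y\ne y',\,z,z'\in\mathcal{U}}\frac{D^l_{z,z'}D^k_{y,y'}f(\mathbf{x})}{\|y-y'\|},$$ where $\|\cdot\|$ is the Euclidean norm. For $Y\subseteq\mathbb{R}^N$, the Gaussian average is $G(Y)=\mathbb{E}\sup_{\mathbf{y}\in Y}\langle\boldsymbol{\gamma},\mathbf{y}\rangle$, where $\boldsymbol{\gamma}$ is a vector of $N$ independent standard normal variables. As usual, $\mathcal{X}$ is a measurable space, and the functions $h$ and $f$ are measurable and such that the expectations appearing are defined. *)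

theory Defs
  imports "HOL-Probability.Probability"
begin

text \<open>Vectors \<open>x \<in> U\<^sup>n\<close> are elements of \<open>{1..n} \<rightarrow>\<^sub>E U\<close>, i.e. extensional functions on \<open>{1..n}\<close>.\<close>

definition partial_diff ::
  "nat \<Rightarrow> 'z \<Rightarrow> 'z \<Rightarrow> ((nat \<Rightarrow> 'z) \<Rightarrow> real) \<Rightarrow> (nat \<Rightarrow> 'z) \<Rightarrow> real" where
  "partial_diff k y y' f x = f (x(k := y)) - f (x(k := y'))"

text \<open>
  The three suprema below are taken in \<open>[0, \<infinity>]\<close>, so they may be infinite. The truncation of negative
  values by \<^const>\<open>ennreal\<close> does not change them: exchanging \<open>y\<close> and \<open>y'\<close> flips the sign of the
  difference. A supremum over an empty range (such as \<open>k \<noteq> l\<close> for \<open>n = 1\<close>) is \<open>0\<close>.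
\<close>

definition M_diff :: "nat \<Rightarrow> (real ^ 'd) set \<Rightarrow> ((nat \<Rightarrow> real ^ 'd) \<Rightarrow> real) \<Rightarrow> ennreal" where
  "M_diff n U f =
     Sup {ennreal (partial_diff k y y' f x) | k x y y'.
            k \<in> {1..n} \<and> x \<in> {1..n} \<rightarrow>\<^sub>E U \<and> y \<in> U \<and> y' \<in> U}"

definition M_Lip :: "nat \<Rightarrow> (real ^ 'd) set \<Rightarrow> ((nat \<Rightarrow> real ^ 'd) \<Rightarrow> real) \<Rightarrow> ennreal" where
  "M_Lip n U f =
     Sup {ennreal (partial_diff k y y' f x / norm (y - y')) | k x y y'.
            k \<in> {1..n} \<and> x \<in> {1..n} \<rightarrow>\<^sub>E U \<and> y \<in> U \<and> y' \<in> U \<and> y \<noteq> y'}"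

definition J_Lip :: "nat \<Rightarrow> (real ^ 'd) set \<Rightarrow> ((nat \<Rightarrow> real ^ 'd) \<Rightarrow> real) \<Rightarrow> ennreal" where
  "J_Lip n U f = of_nat n *
     Sup {ennreal (partial_diff l z z' (partial_diff k y y' f) x / norm (y - y')) | k l x y y' z z'.
            k \<in> {1..n} \<and> l \<in> {1..n} \<and> k \<noteq> l \<and> x \<in> {1..n} \<rightarrow>\<^sub>E U \<and>
            y \<in> U \<and> y' \<in> U \<and> y \<noteq> y' \<and> z \<in> U \<and> z' \<in> U}"

text \<open>
  The Gaussian average of a set \<open>Y\<close> of vectors with coordinates indexed by a finite set \<open>I\<close>. The real
  supremum and integral are meaningful for bounded nonempty \<open>Y\<close>, and the value is then nonnegative.
\<close>

definition gaussian_average :: "'i set \<Rightarrow> ('i \<Rightarrow> real) set \<Rightarrow> real" where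
  "gaussian_average I Y =
     (\<integral>\<gamma>. (SUP y\<in>Y. \<Sum>i\<in>I. \<gamma> i * y i)
        \<partial>(PiM I (\<lambda>_. density lborel (\<lambda>t. ennreal (std_normal_density t)))))"

definition map_vec :: "nat \<Rightarrow> ('x \<Rightarrow> 'z) \<Rightarrow> (nat \<Rightarrow> 'x) \<Rightarrow> (nat \<Rightarrow> 'z)" where
  "map_vec n h x = (\<lambda>k\<in>{1..n}. h (x k))"

text \<open>\<open>\<real>\<^sup>d\<^sup>n\<close> is identified with the real families indexed by \<open>{1..n} \<times> UNIV\<close>, where \<open>UNIV\<close> has \<open>d\<close> elements.\<close>

definition stack :: "nat \<Rightarrow> (nat \<Rightarrow> real ^ 'd) \<Rightarrow> nat \<times> 'd \<Rightarrow> real" where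
  "stack n u = (\<lambda>(k, j)\<in>{1..n} \<times> UNIV. u k $ j)"

definition eval_class ::
  "nat \<Rightarrow> ('x \<Rightarrow> real ^ 'd) set \<Rightarrow> (nat \<Rightarrow> 'x) \<Rightarrow> (nat \<times> 'd \<Rightarrow> real) set" where
  "eval_class n H x = (\<lambda>h. stack n (map_vec n h x)) ` H"

end

theory Submission
  imports Defs
begin

text \<open>
  Write \<open>M\<close>, \<open>L\<close> and \<open>J\<close> for \<open>M_diff n U f\<close>, \<open>M_Lip n U f\<close> and \<open>J_Lip n U f\<close>, and \<open>K = {1..n}\<close>. The
  supremum \<open>\<Phi> x = (SUP h. E f(h(X')) - f(h(x)))\<close> changes by at most \<open>M\<close> when one coordinate of the
  sample changes. By the bounded difference inequality (\<open>bounded_differences_concentration\<close>) it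
  exceeds its mean by more than \<open>M * sqrt (n * ln (1/\<delta>))\<close> with probability at most \<open>\<delta>\<close>. What has to
  be shown is that the mean of \<open>\<Phi>\<close> is at most a multiple of the expected Gaussian average.

  The mean of \<open>\<Phi>\<close> is at most the mean of \<open>SUP h. f(h(x)) - f(h(x'))\<close> over two independent samples.
  Exchanging \<open>x k\<close> and \<open>x' k\<close> for all \<open>k\<close> in a set \<open>A \<subseteq> K\<close> does not change the law of the pair
  (\<open>distr_mix_pair\<close>), so one may average over all \<open>A\<close>, with the samples held fixed. If \<open>f\<close> is a sum of
  functions of single coordinates, this average is a Rademacher average. In general
  \<open>Y h A = f(h(mix A)) - f(h(mix (K - A)))\<close> is a function on the cube of subsets \<open>A\<close> that need not be
  linear in the signs.

  The idea is that linearity is not needed to pass to Gaussian variables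
  (\<open>cube_gauss_comparison\<close>): the coordinates of the cube can be averaged out one at a time. Averaging
  out coordinate \<open>k\<close> leaves the mean of the two values of \<open>Y h\<close>, plus a random sign times half of their
  difference. If these half differences, as functions of \<open>h\<close>, have increments bounded by the distances
  of vectors \<open>c k * v h\<close>, uniformly in the other coordinates, then the sign term can be replaced by
  \<open>sqrt (pi/2)\<close> times a Gaussian linear form in \<open>c k * v h\<close>, because the mean of \<open>\<bar>\<langle>\<gamma>, w\<rangle>\<bar>\<close> is
  \<open>sqrt (2/pi) * norm w\<close> (\<open>rademacher_gauss_step\<close>). At the end only the mean of \<open>Y h\<close> over the cube is
  left, which vanishes since \<open>Y h\<close> changes sign under \<open>A \<mapsto> K - A\<close>, plus a Gaussian process in which
  the variances of the \<open>n\<close> steps add up (\<open>distr_gauss_rotation\<close>).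

  The half differences are mean values of two partial differences of \<open>f\<close>. Passing from \<open>h\<close> to \<open>h'\<close> in
  one of them changes the two points that are substituted, which costs \<open>L\<close> times the distance they
  move, and it changes the background vector one coordinate at a time. Each of these changes is a
  second order difference and costs \<open>J/n\<close> times the distance moved. The Cauchy-Schwarz inequality with
  these costs as weights (of total mass \<open>2L + J\<close>) turns the bound into a Euclidean distance, and summing
  the squared weights over \<open>k\<close> gives each coordinate of the pair of samples the variance
  \<open>(2L + J)\<^sup>2 / 2\<close> (\<open>symmetrized_gauss_bound\<close>). Since a pair of samples contributes two Gaussian
  averages, the mean of \<open>\<Phi>\<close> is at most \<open>sqrt pi * (2L + J)\<close> times the expected Gaussian average.

  If \<open>L\<close> or \<open>J\<close> is infinite, the bound on the mean says something only if the expected Gaussian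
  average vanishes. Then all \<open>h\<close> almost surely agree on the sample and the mean of \<open>\<Phi>\<close> is \<open>0\<close>.
\<close>

section \<open>Finite suprema\<close>

lemma finite_SUP_upper:
  fixes g :: "'h \<Rightarrow> real"
  assumes "finite H" "h \<in> H"
  shows "g h \<le> (SUP h\<in>H. g h)"
  using assms by (intro cSUP_upper bdd_above_finite) auto

lemma finite_SUP_attained:
  fixes g :: "'h \<Rightarrow> real"
  assumes "finite H" "H \<noteq> {}"
  obtains h where "h \<in> H" "(SUP h\<in>H. g h) = g h"
proof -
  have "(SUP h\<in>H. g h) = Max (g ` H)"
    using assms by (intro cSup_eq_Max) auto
  moreover have "Max (g ` H) \<in> g ` H"
    using assms by (intro Max_in) auto
  ultimately show ?thesis using that by auto
qed

lemma borel_measurable_finite_SUP: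
  fixes g :: "'h \<Rightarrow> 'a \<Rightarrow> real"
  assumes "finite H" "\<And>h. h \<in> H \<Longrightarrow> g h \<in> borel_measurable M"
  shows "(\<lambda>x. SUP h\<in>H. g h x) \<in> borel_measurable M"
  using assms by (intro borel_measurable_cSUP bdd_above_finite countable_finite) auto

lemma abs_finite_SUP_le_sum:
  fixes g :: "'h \<Rightarrow> real"
  assumes "finite H" "H \<noteq> {}"
  shows "\<bar>SUP h\<in>H. g h\<bar> \<le> (\<Sum>h\<in>H. \<bar>g h\<bar>)"
proof -
  obtain h where "h \<in> H" "(SUP h\<in>H. g h) = g h"
    using finite_SUP_attained[OF assms, of g] .
  moreover have "\<bar>g h\<bar> \<le> (\<Sum>h\<in>H. \<bar>g h\<bar>)"
    using assms \<open>h \<in> H\<close> by (intro member_le_sum) auto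
  ultimately show ?thesis by simp
qed

lemma integrable_finite_SUP:
  fixes g :: "'h \<Rightarrow> 'a \<Rightarrow> real"
  assumes "finite H" "H \<noteq> {}" "\<And>h. h \<in> H \<Longrightarrow> integrable M (g h)"
  shows "integrable M (\<lambda>x. SUP h\<in>H. g h x)"
proof (rule Bochner_Integration.integrable_bound[where f = "\<lambda>x. \<Sum>h\<in>H. \<bar>g h x\<bar>"])
  show "integrable M (\<lambda>x. \<Sum>h\<in>H. \<bar>g h x\<bar>)" using assms by auto
  show "(\<lambda>x. SUP h\<in>H. g h x) \<in> borel_measurable M"
    using assms by (intro borel_measurable_finite_SUP) auto
  show "AE x in M. norm (SUP h\<in>H. g h x) \<le> norm (\<Sum>h\<in>H. \<bar>g h x\<bar>)"
    using abs_finite_SUP_le_sum[OF assms(1,2)] by (auto intro: order.trans[OF _ abs_ge_self])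
qed

lemma finite_SUP_diff_le:
  fixes a b :: "'h \<Rightarrow> real" and c :: real
  assumes H: "finite H" "H \<noteq> {}" and ab: "\<And>h. h \<in> H \<Longrightarrow> \<bar>a h - b h\<bar> \<le> c"
  shows "\<bar>(SUP h\<in>H. a h) - (SUP h\<in>H. b h)\<bar> \<le> c"
proof -
  have "a h \<le> (SUP h\<in>H. b h) + c" if "h \<in> H" for h
    using ab[OF that] finite_SUP_upper[OF H(1) that, of b] by linarith
  then have 1: "(SUP h\<in>H. a h) \<le> (SUP h\<in>H. b h) + c"
    by (rule cSUP_least[OF H(2)])
  have "b h \<le> (SUP h\<in>H. a h) + c" if "h \<in> H" for h
    using ab[OF that] finite_SUP_upper[OF H(1) that, of a] by linarith
  then have 2: "(SUP h\<in>H. b h) \<le> (SUP h\<in>H. a h) + c"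
    by (rule cSUP_least[OF H(2)])
  show ?thesis using 1 2 by linarith
qed

section \<open>Doubled product spaces\<close>

lemma sum_Times_bool:
  "(\<Sum>p\<in>K \<times> (UNIV :: bool set). F p) = (\<Sum>k\<in>K. F (k, True) + (F (k, False) :: real))"
  unfolding sum.cartesian_product' by (simp add: UNIV_bool add.commute)

lemma indep_vars_PiM_coordinates:
  assumes "\<And>i. i \<in> I \<Longrightarrow> prob_space (M i)"
  shows "prob_space.indep_vars (PiM I M) M (\<lambda>i \<omega>. \<omega> i) I"
proof (cases "I = {}")
  case True
  interpret prob_space "PiM I M" using assms by (intro prob_space_PiM)
  show ?thesis unfolding indep_vars_def2 indep_sets_def using True by auto
next
  case False
  interpret prob_space "PiM I M" using assms by (intro prob_space_PiM)
  show ?thesis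
  proof (subst indep_vars_iff_distr_eq_PiM'[OF False])
    show "distr (PiM I M) (PiM I M) (\<lambda>x. \<lambda>i\<in>I. x i) = (\<Pi>\<^sub>M i\<in>I. distr (PiM I M) (M i) (\<lambda>\<omega>. \<omega> i))"
    proof -
      have "distr (PiM I M) (PiM I M) (\<lambda>x. \<lambda>i\<in>I. x i) = distr (PiM I M) (PiM I M) (\<lambda>x. x)"
        by (intro distr_cong) (auto simp: space_PiM PiE_def extensional_restrict)
      also have "\<dots> = PiM I M" by simp
      also have "\<dots> = (\<Pi>\<^sub>M i\<in>I. distr (PiM I M) (M i) (\<lambda>\<omega>. \<omega> i))"
        using assms by (intro PiM_cong) (auto simp: distr_PiM_component)
      finally show ?thesis .
    qed
  qed auto
qed

definition half :: "'k set \<Rightarrow> bool \<Rightarrow> ('k \<times> bool \<Rightarrow> 'x) \<Rightarrow> 'k \<Rightarrow> 'x" where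
  "half K b \<omega> = (\<lambda>k\<in>K. \<omega> (k, b))"

text \<open>
  Two independent samples from the same product measure, as one product measure over the index set
  \<open>K \<times> UNIV\<close>. In this form an exchange of coordinates between the two samples is a permutation of the
  indices, and disjoint groups of coordinates are independent by the library's results on families.
\<close>

abbreviation doubled :: "'k set \<Rightarrow> ('k \<Rightarrow> 'x measure) \<Rightarrow> ('k \<times> bool \<Rightarrow> 'x) measure" where
  "doubled K M \<equiv> PiM (K \<times> UNIV) (\<lambda>i. M (fst i))"

lemma measurable_half [measurable]: "half K b \<in> measurable (doubled K M) (PiM K M)"
  unfolding half_def by (intro measurable_restrict) (rule measurable_component_singleton[of "(_, b)" _ "\<lambda>i. M (fst i)", simplified], simp)

lemma distr_doubled_half:
  assumes M: "\<And>k. k \<in> K \<Longrightarrow> prob_space (M k)"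
  shows "distr (doubled K M) (PiM K M) (half K b) = PiM K M"
  using distr_PiM_reindex[of "K \<times> UNIV" "\<lambda>i. M (fst i)" "\<lambda>k. (k, b)" K] M
  by (auto simp: half_def[abs_def] inj_on_def)

text \<open>
  The halves depend on disjoint sets of coordinates, so they are independent.
\<close>

lemma distr_doubled_halves:
  assumes M: "\<And>k. k \<in> K \<Longrightarrow> prob_space (M k)"
  shows "distr (doubled K M) (PiM K M \<Otimes>\<^sub>M PiM K M) (\<lambda>\<omega>. (half K True \<omega>, half K False \<omega>))
         = PiM K M \<Otimes>\<^sub>M PiM K M"
proof -
  interpret N: prob_space "doubled K M" using M by (intro prob_space_PiM) auto
  have half_distr: "distr (doubled K M) (PiM K M) (half K b) = PiM K M" for b
    using M by (rule distr_doubled_half)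
  have ind: "N.indep_vars (\<lambda>i. M (fst i)) (\<lambda>i \<omega>. \<omega> i) (K \<times> UNIV)"
    using M by (intro indep_vars_PiM_coordinates) auto
  let ?r = "\<lambda>b. \<lambda>y. (\<lambda>k\<in>K. y (k, b))"
  have meas: "?r b \<in> measurable (PiM (K \<times> {b}) (\<lambda>i. M (fst i))) (PiM K M)" for b
    by (intro measurable_restrict)
      (rule measurable_component_singleton[of "(_, b)" _ "\<lambda>i. M (fst i)", simplified], simp)
  have r: "?r b \<circ> (\<lambda>\<omega>. restrict \<omega> (K \<times> {b})) = half K b" for b
    by (auto simp: half_def fun_eq_iff)
  have "N.indep_var (PiM K M) (?r True \<circ> (\<lambda>\<omega>. restrict \<omega> (K \<times> {True})))
                    (PiM K M) (?r False \<circ> (\<lambda>\<omega>. restrict \<omega> (K \<times> {False})))"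
    using N.indep_var_restrict[OF ind, of "K \<times> {True}" "K \<times> {False}"]
    by (intro N.indep_var_compose[OF _ meas meas]) auto
  then show ?thesis
    unfolding r N.indep_var_distribution_eq half_distr by simp
qed

lemma integrable_comp_fst:
  fixes f :: "'a \<Rightarrow> real"
  assumes "prob_space M2" "integrable M1 f"
  shows "integrable (M1 \<Otimes>\<^sub>M M2) (\<lambda>p. f (fst p))"
  using assms prob_space.distr_pair_fst[of M2 M1] by (intro integrable_distr[OF measurable_fst]) simp

lemma integrable_comp_snd:
  fixes f :: "'a \<Rightarrow> real"
  assumes "prob_space M1" "prob_space M2" "integrable M2 f"
  shows "integrable (M1 \<Otimes>\<^sub>M M2) (\<lambda>p. f (snd p))"
proof -
  interpret M1: prob_space M1 by fact
  interpret M2: prob_space M2 by fact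
  interpret pair_sigma_finite M2 M1 ..
  show ?thesis
    using integrable_product_swap[OF integrable_comp_fst[OF assms(1,3)]] by (simp add: case_prod_unfold)
qed

section \<open>Gaussian linear forms\<close>

abbreviation std_normal :: "real measure" where
  "std_normal \<equiv> density lborel (\<lambda>t. ennreal (std_normal_density t))"

abbreviation gauss :: "'i set \<Rightarrow> ('i \<Rightarrow> real) measure" where
  "gauss I \<equiv> PiM I (\<lambda>_. std_normal)"

lemma prob_space_std_normal: "prob_space std_normal"
  by (rule prob_space_normal_density) simp

lemma prob_space_gauss: "prob_space (gauss I)"
  by (intro prob_space_PiM prob_space_std_normal)

lemma measurable_gauss_component:
  "i \<in> I \<Longrightarrow> (\<lambda>\<gamma>. \<gamma> i) \<in> borel_measurable (gauss I)"
  using measurable_component_singleton[of i I "\<lambda>_. std_normal"] by simp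

lemma integrable_std_normal_id: "integrable std_normal (\<lambda>x. x)"
  using integrable_std_normal_moment[of 1] by (subst integrable_density) auto

lemma integral_std_normal_abs: "(\<integral>x. \<bar>x\<bar> \<partial>std_normal) = sqrt (2 / pi)"
  using integral_std_normal_moment_abs_odd[of 0] by (subst integral_density) auto

lemma integrable_gauss_component:
  assumes "i \<in> I"
  shows "integrable (gauss I) (\<lambda>\<gamma>. \<gamma> i)"
proof -
  have "integrable (distr (gauss I) std_normal (\<lambda>\<gamma>. \<gamma> i)) (\<lambda>x. x)"
    using assms prob_space_std_normal integrable_std_normal_id by (subst distr_PiM_component) auto
  then show ?thesis
    using assms by (subst (asm) integrable_distr_eq) auto
qed

lemma measurable_std_normal_density:
  "(\<lambda>x. ennreal (std_normal_density x)) \<in> borel_measurable lborel"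
  by simp

lemma distributed_gauss_component:
  assumes "i \<in> I"
  shows "distributed (gauss I) lborel (\<lambda>\<gamma>. \<gamma> i) std_normal_density"
  unfolding distributed_def
proof (intro conjI)
  have "distr (gauss I) lborel (\<lambda>\<gamma>. \<gamma> i) = distr (gauss I) std_normal (\<lambda>\<gamma>. \<gamma> i)"
    by (intro distr_cong) auto
  also have "\<dots> = std_normal"
    using assms prob_space_std_normal by (intro distr_PiM_component)
  finally show "distr (gauss I) lborel (\<lambda>\<gamma>. \<gamma> i) = std_normal" .
  show "(\<lambda>\<gamma>. \<gamma> i) \<in> measurable (gauss I) lborel"
    unfolding measurable_lborel1 using assms by (rule measurable_gauss_component)
qed (rule measurable_std_normal_density)

lemma distr_std_normal_scale:
  assumes "0 < \<sigma>"
  shows "distr std_normal lborel (\<lambda>x. \<sigma> * x) = density lborel (normal_density 0 \<sigma>)"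
proof -
  interpret S: prob_space std_normal by (rule prob_space_std_normal)
  have "distributed std_normal lborel (\<lambda>x. x) std_normal_density"
    unfolding distributed_def
  proof (intro conjI)
    show "distr std_normal lborel (\<lambda>x. x) = std_normal" by (rule distr_id2) (simp only: sets_density)
    show "(\<lambda>x. x) \<in> measurable std_normal lborel" by (rule measurable_ident_sets) (simp only: sets_density)
  qed (rule measurable_std_normal_density)
  then have "distributed std_normal lborel (\<lambda>x. 0 + \<sigma> * x) (normal_density (0 + \<sigma> * 0) (\<bar>\<sigma>\<bar> * 1))"
    by (rule S.normal_density_affine) (use assms in auto)
  then show ?thesis
    unfolding distributed_def add_0 mult_zero_right mult_1_right abs_of_pos[OF assms] by (rule conjunct1)
qed

text \<open>
  A linear form with coefficients \<open>w\<close> is normal with variance \<open>\<Sum> w\<^sup>2\<close>. The law is written as the image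
  of \<open>std_normal\<close> under a scaling, not as a density, so that the degenerate case \<open>w = 0\<close> is included.
\<close>

lemma distr_gauss_linear_form:
  assumes "finite I" "J \<subseteq> I"
  shows "distr (gauss I) borel (\<lambda>\<gamma>. \<Sum>j\<in>J. w j * \<gamma> j)
       = distr std_normal borel (\<lambda>x. sqrt (\<Sum>j\<in>J. (w j)\<^sup>2) * x)"
proof -
  interpret G: prob_space "gauss I" by (rule prob_space_gauss)
  interpret S: prob_space std_normal by (rule prob_space_std_normal)
  define J' where "J' = {j \<in> J. w j \<noteq> 0}"
  have fin: "finite J" using assms by (rule rev_finite_subset)
  then have fin': "finite J'" unfolding J'_def by simp
  have sum_eq: "(\<Sum>j\<in>J. w j * \<gamma> j) = (\<Sum>j\<in>J'. w j * \<gamma> j)" for \<gamma> :: "'a \<Rightarrow> real"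
    using fin by (intro sum.mono_neutral_right) (auto simp: J'_def)
  have sq_eq: "(\<Sum>j\<in>J. (w j)\<^sup>2) = (\<Sum>j\<in>J'. \<bar>w j\<bar>\<^sup>2)"
    using fin by (intro sum.mono_neutral_cong_right) (auto simp: J'_def)
  show ?thesis
  proof (cases "J' = {}")
    case True
    then show ?thesis unfolding sum_eq sq_eq
      by (simp add: G.distr_const S.distr_const)
  next
    case False
    have pos: "0 < sqrt (\<Sum>j\<in>J'. \<bar>w j\<bar>\<^sup>2)"
      using fin' False by (intro real_sqrt_gt_zero sum_pos) (auto simp: J'_def)
    have "G.indep_vars (\<lambda>_. std_normal) (\<lambda>i \<gamma>. \<gamma> i) J'"
      using assms by (intro G.indep_vars_subset[OF indep_vars_PiM_coordinates] prob_space_std_normal)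
        (auto simp: J'_def)
    then have ind: "G.indep_vars (\<lambda>_. borel) (\<lambda>i \<gamma>. w i * \<gamma> i) J'"
      by (rule G.indep_vars_compose2) auto
    have "distributed (gauss I) lborel (\<lambda>\<gamma>. \<gamma> i) std_normal_density" if "i \<in> J'" for i
      using that assms by (intro distributed_gauss_component) (auto simp: J'_def)
    then have "distributed (gauss I) lborel (\<lambda>\<gamma>. w i * \<gamma> i) (normal_density 0 \<bar>w i\<bar>)" if "i \<in> J'" for i
      using G.normal_density_affine[of "\<lambda>\<gamma>. \<gamma> i" 0 1 "w i" 0, OF _ zero_less_one] that by (simp add: J'_def)
    then have "distributed (gauss I) lborel (\<lambda>\<gamma>. \<Sum>j\<in>J'. w j * \<gamma> j)
                 (normal_density (\<Sum>j\<in>J'. 0) (sqrt (\<Sum>j\<in>J'. \<bar>w j\<bar>\<^sup>2)))"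
      using fin' False ind by (intro G.sum_indep_normal) (auto simp: J'_def)
    then have 1: "distr (gauss I) lborel (\<lambda>\<gamma>. \<Sum>j\<in>J'. w j * \<gamma> j)
                 = density lborel (normal_density 0 (sqrt (\<Sum>j\<in>J'. \<bar>w j\<bar>\<^sup>2)))"
      unfolding distributed_def sum.neutral_const by (rule conjunct1)
    have 2: "distr (gauss I) lborel (\<lambda>\<gamma>. \<Sum>j\<in>J'. w j * \<gamma> j)
                   = distr std_normal lborel (\<lambda>x. sqrt (\<Sum>j\<in>J'. \<bar>w j\<bar>\<^sup>2) * x)"
      unfolding distr_std_normal_scale[OF pos] by (rule 1)
    have 3: "distr (gauss I) lborel g = distr (gauss I) borel g" for g
      by (rule distr_cong) auto
    have 4: "distr std_normal lborel g = distr std_normal borel g" for g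
      by (rule distr_cong) auto
    show ?thesis
      using 2 unfolding sum_eq sq_eq 3 4 .
  qed
qed

lemma gauss_linear_form_measurable:
  assumes "J \<subseteq> I"
  shows "(\<lambda>\<gamma>. \<Sum>j\<in>J. w j * \<gamma> j) \<in> borel_measurable (gauss I)"
  using assms by (intro borel_measurable_sum borel_measurable_times) auto

lemma expectation_abs_gauss_linear_form:
  assumes "finite I"
  shows "(\<integral>\<gamma>. \<bar>\<Sum>i\<in>I. w i * \<gamma> i\<bar> \<partial>gauss I) = sqrt (2 / pi) * sqrt (\<Sum>i\<in>I. (w i)\<^sup>2)"
proof -
  have "(\<integral>\<gamma>. \<bar>\<Sum>i\<in>I. w i * \<gamma> i\<bar> \<partial>gauss I)
      = (\<integral>x. \<bar>x\<bar> \<partial>distr (gauss I) borel (\<lambda>\<gamma>. \<Sum>i\<in>I. w i * \<gamma> i))"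
    by (subst integral_distr) (auto intro!: gauss_linear_form_measurable)
  also have "\<dots> = (\<integral>x. \<bar>sqrt (\<Sum>i\<in>I. (w i)\<^sup>2) * x\<bar> \<partial>std_normal)"
    unfolding distr_gauss_linear_form[OF assms order.refl] by (subst integral_distr) auto
  also have "\<dots> = sqrt (\<Sum>i\<in>I. (w i)\<^sup>2) * (\<integral>x. \<bar>x\<bar> \<partial>std_normal)"
    by (simp add: abs_mult sum_nonneg)
  finally show ?thesis by (simp add: integral_std_normal_abs)
qed

text \<open>
  Two independent Gaussian vectors with coordinatewise scales \<open>c\<close> and \<open>s\<close> add up to one Gaussian vector
  with scale \<open>sqrt (c\<^sup>2 + s\<^sup>2)\<close>. This keeps the Gaussian vector at a fixed index set when the coordinates
  of the cube are averaged out one after the other, and it makes their contributions add in square.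
\<close>

lemma distr_gauss_rotation:
  assumes I: "finite I" "I \<noteq> {}"
  shows "distr (gauss I \<Otimes>\<^sub>M gauss I) (PiM I (\<lambda>_. borel)) (\<lambda>(\<gamma>, \<gamma>'). \<lambda>i\<in>I. c i * \<gamma> i + s i * \<gamma>' i)
       = distr (gauss I) (PiM I (\<lambda>_. borel)) (\<lambda>\<gamma>. \<lambda>i\<in>I. sqrt ((c i)\<^sup>2 + (s i)\<^sup>2) * \<gamma> i)"
proof -
  let ?N = "gauss (I \<times> (UNIV :: bool set))"
  interpret N: prob_space ?N by (rule prob_space_gauss)
  interpret G: prob_space "gauss I" by (rule prob_space_gauss)
  define w where "w = (\<lambda>(i, b). if b then c i else s i)"
  define Z where "Z = (\<lambda>i \<omega>. \<Sum>j\<in>{i} \<times> (UNIV :: bool set). w j * \<omega> j)"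
  have Z: "Z i \<omega> = c i * \<omega> (i, True) + s i * \<omega> (i, False)" for i \<omega>
    unfolding Z_def w_def by (simp add: sum_Times_bool)
  have Zmeas: "Z i \<in> borel_measurable ?N" if "i \<in> I" for i
    unfolding Z_def using that by (intro gauss_linear_form_measurable) auto
  have half [measurable]: "half I b \<in> measurable ?N (gauss I)" for b
    using measurable_half[of I b "\<lambda>_. std_normal"] by simp

  have "distr (gauss I \<Otimes>\<^sub>M gauss I) (PiM I (\<lambda>_. borel)) (\<lambda>(\<gamma>, \<gamma>'). \<lambda>i\<in>I. c i * \<gamma> i + s i * \<gamma>' i)
      = distr (distr ?N (gauss I \<Otimes>\<^sub>M gauss I) (\<lambda>\<omega>. (half I True \<omega>, half I False \<omega>)))
          (PiM I (\<lambda>_. borel)) (\<lambda>(\<gamma>, \<gamma>'). \<lambda>i\<in>I. c i * \<gamma> i + s i * \<gamma>' i)"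
    using distr_doubled_halves[of I "\<lambda>_. std_normal"] prob_space_std_normal by simp
  also have "\<dots> = distr ?N (PiM I (\<lambda>_. borel)) (\<lambda>\<omega>. \<lambda>i\<in>I. Z i \<omega>)"
  proof (subst distr_distr)
    show "(\<lambda>(\<gamma>, \<gamma>'). \<lambda>i\<in>I. c i * \<gamma> i + s i * \<gamma>' i)
        \<in> measurable (gauss I \<Otimes>\<^sub>M gauss I) (PiM I (\<lambda>_. borel))"
      unfolding split_beta
      by (intro measurable_restrict borel_measurable_add borel_measurable_times borel_measurable_const
          measurable_compose[OF measurable_fst] measurable_compose[OF measurable_snd]
          measurable_gauss_component)
  qed (auto simp: Z half_def o_def intro!: distr_cong)
  also have "\<dots> = (\<Pi>\<^sub>M i\<in>I. distr ?N borel (Z i))"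
  proof -
    have "N.indep_vars (\<lambda>_. std_normal) (\<lambda>j \<omega>. \<omega> j) (I \<times> UNIV)"
      by (intro indep_vars_PiM_coordinates prob_space_std_normal)
    then have "N.indep_vars (\<lambda>i. PiM ({i} \<times> UNIV) (\<lambda>_. std_normal)) (\<lambda>i \<omega>. restrict \<omega> ({i} \<times> UNIV)) I"
      by (rule N.indep_vars_restrict) (auto simp: disjoint_family_on_def)
    then have "N.indep_vars (\<lambda>_. borel) (\<lambda>i \<omega>. \<Sum>j\<in>{i} \<times> UNIV. w j * restrict \<omega> ({i} \<times> UNIV) j) I"
      by (rule N.indep_vars_compose2) (auto intro!: gauss_linear_form_measurable)
    then have "N.indep_vars (\<lambda>_. borel) Z I"
      unfolding Z_def by (rule N.indep_vars_cong[THEN iffD1, rotated -1]) auto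
    then show ?thesis
      using N.indep_vars_iff_distr_eq_PiM'[of I Z "\<lambda>_. borel"] I Zmeas by simp
  qed
  also have "\<dots> = (\<Pi>\<^sub>M i\<in>I. distr (gauss I) borel (\<lambda>\<gamma>. sqrt ((c i)\<^sup>2 + (s i)\<^sup>2) * \<gamma> i))"
  proof (intro PiM_cong refl)
    fix i assume i: "i \<in> I"
    have "distr ?N borel (Z i) = distr std_normal borel (\<lambda>x. sqrt (\<Sum>j\<in>{i} \<times> UNIV. (w j)\<^sup>2) * x)"
      unfolding Z_def using I i by (intro distr_gauss_linear_form) auto
    also have "(\<Sum>j\<in>{i} \<times> UNIV. (w j)\<^sup>2) = (c i)\<^sup>2 + (s i)\<^sup>2"
      unfolding w_def by (simp add: sum_Times_bool)
    also have "distr std_normal borel (\<lambda>x. sqrt ((c i)\<^sup>2 + (s i)\<^sup>2) * x)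
             = distr (gauss I) borel (\<lambda>\<gamma>. sqrt ((c i)\<^sup>2 + (s i)\<^sup>2) * \<gamma> i)"
      using distr_gauss_linear_form[of I "{i}" "\<lambda>i. sqrt ((c i)\<^sup>2 + (s i)\<^sup>2)"] I i by simp
    finally show "distr ?N borel (Z i) = \<dots>" .
  qed
  also have "\<dots> = distr (gauss I) (PiM I (\<lambda>_. borel)) (\<lambda>\<gamma>. \<lambda>i\<in>I. sqrt ((c i)\<^sup>2 + (s i)\<^sup>2) * \<gamma> i)"
  proof -
    have "G.indep_vars (\<lambda>_. borel) (\<lambda>i \<gamma>. sqrt ((c i)\<^sup>2 + (s i)\<^sup>2) * \<gamma> i) I"
      by (rule G.indep_vars_compose2[OF indep_vars_PiM_coordinates[OF prob_space_std_normal]]) auto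
    then show ?thesis
      by (subst (asm) G.indep_vars_iff_distr_eq_PiM') (use I in auto)
  qed
  finally show ?thesis .
qed

lemma integrable_gauss_linear_form:
  assumes "J \<subseteq> I"
  shows "integrable (gauss I) (\<lambda>\<gamma>. \<Sum>j\<in>J. w j * \<gamma> j)"
  using assms
  by (intro Bochner_Integration.integrable_sum integrable_mult_right integrable_gauss_component) auto

lemma expectation_gauss_rotation:
  fixes F :: "('i \<Rightarrow> real) \<Rightarrow> real"
  assumes I: "finite I" "I \<noteq> {}" and F: "F \<in> borel_measurable (PiM I (\<lambda>_. borel))"
  shows "(\<integral>p. F (\<lambda>i\<in>I. c i * fst p i + s i * snd p i) \<partial>(gauss I \<Otimes>\<^sub>M gauss I))
       = (\<integral>\<gamma>. F (\<lambda>i\<in>I. sqrt ((c i)\<^sup>2 + (s i)\<^sup>2) * \<gamma> i) \<partial>gauss I)"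
proof -
  have 1: "(\<lambda>(\<gamma>, \<gamma>'). \<lambda>i\<in>I. c i * \<gamma> i + s i * \<gamma>' i)
        \<in> measurable (gauss I \<Otimes>\<^sub>M gauss I) (PiM I (\<lambda>_. borel))"
    unfolding split_beta
    by (intro measurable_restrict borel_measurable_add borel_measurable_times borel_measurable_const
        measurable_compose[OF measurable_fst] measurable_compose[OF measurable_snd]
        measurable_gauss_component)
  have 2: "(\<lambda>\<gamma>. \<lambda>i\<in>I. sqrt ((c i)\<^sup>2 + (s i)\<^sup>2) * \<gamma> i) \<in> measurable (gauss I) (PiM I (\<lambda>_. borel))"
    by (intro measurable_restrict borel_measurable_times borel_measurable_const measurable_gauss_component)
  show ?thesis
    using arg_cong[OF distr_gauss_rotation[OF I, of c s], of "\<lambda>M. integral\<^sup>L M F"]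
    unfolding integral_distr[OF 1 F] integral_distr[OF 2 F] by (simp add: split_beta)
qed

text \<open>
  A shift can only increase the mean absolute value of a symmetric variable \<open>\<zeta>\<close>: by symmetry
  \<open>\<bar>d + \<zeta>\<bar>\<close> and \<open>\<bar>d - \<zeta>\<bar>\<close> have the same mean, and they add up to at least \<open>2 * \<bar>\<zeta>\<bar>\<close>.
\<close>

lemma expectation_abs_shifted_gauss_linear_form:
  assumes "finite I"
  shows "sqrt (2 / pi) * sqrt (\<Sum>i\<in>I. (w i)\<^sup>2) \<le> (\<integral>\<gamma>. \<bar>d + (\<Sum>i\<in>I. w i * \<gamma> i)\<bar> \<partial>gauss I)"
proof -
  interpret G: prob_space "gauss I" by (rule prob_space_gauss)
  let ?L = "\<lambda>w \<gamma>. \<Sum>i\<in>I. w i * \<gamma> i"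
  have int [simp]: "integrable (gauss I) (?L w)" for w
    by (rule integrable_gauss_linear_form) simp
  have law: "(\<integral>\<gamma>. \<bar>d + ?L w \<gamma>\<bar> \<partial>gauss I) = (\<integral>x. \<bar>d + sqrt (\<Sum>i\<in>I. (w i)\<^sup>2) * x\<bar> \<partial>std_normal)" for w
  proof -
    have "(\<integral>\<gamma>. \<bar>d + ?L w \<gamma>\<bar> \<partial>gauss I) = (\<integral>x. \<bar>d + x\<bar> \<partial>distr (gauss I) borel (?L w))"
      by (subst integral_distr) (auto intro!: gauss_linear_form_measurable)
    also have "\<dots> = (\<integral>x. \<bar>d + sqrt (\<Sum>i\<in>I. (w i)\<^sup>2) * x\<bar> \<partial>std_normal)"
      unfolding distr_gauss_linear_form[OF assms order.refl] by (subst integral_distr) auto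
    finally show ?thesis .
  qed
  have "2 * (\<integral>\<gamma>. \<bar>?L w \<gamma>\<bar> \<partial>gauss I) = (\<integral>\<gamma>. 2 * \<bar>?L w \<gamma>\<bar> \<partial>gauss I)"
    by simp
  also have "\<dots> \<le> (\<integral>\<gamma>. \<bar>d + ?L w \<gamma>\<bar> + \<bar>d + ?L (\<lambda>i. - w i) \<gamma>\<bar> \<partial>gauss I)"
    by (intro integral_mono) (auto simp: sum_negf)
  also have "\<dots> = (\<integral>\<gamma>. \<bar>d + ?L w \<gamma>\<bar> \<partial>gauss I) + (\<integral>\<gamma>. \<bar>d + ?L (\<lambda>i. - w i) \<gamma>\<bar> \<partial>gauss I)"
    by (intro Bochner_Integration.integral_add integrable_abs Bochner_Integration.integrable_add int) auto
  also have "\<dots> = 2 * (\<integral>\<gamma>. \<bar>d + ?L w \<gamma>\<bar> \<partial>gauss I)"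
    unfolding law by simp
  finally show ?thesis
    using expectation_abs_gauss_linear_form[OF assms, of w] by simp
qed

text \<open>
  The maximum is half the sum plus half the distance of its arguments; the linear forms have mean zero.
\<close>

lemma expectation_max_gauss_linear_forms:
  assumes "finite I"
  shows "(a + b + sqrt (2 / pi) * sqrt (\<Sum>i\<in>I. (v i - v' i)\<^sup>2)) / 2
       \<le> (\<integral>\<gamma>. max (a + (\<Sum>i\<in>I. v i * \<gamma> i)) (b + (\<Sum>i\<in>I. v' i * \<gamma> i)) \<partial>gauss I)"
proof -
  interpret G: prob_space "gauss I" by (rule prob_space_gauss)
  let ?L = "\<lambda>w \<gamma>. \<Sum>i\<in>I. w i * \<gamma> i"
  have int [simp]: "integrable (gauss I) (?L w)" for w
    by (rule integrable_gauss_linear_form) simp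
  have mean: "(\<integral>\<gamma>. ?L w \<gamma> \<partial>gauss I) = 0" for w
  proof -
    have "(\<integral>\<gamma>. \<gamma> i \<partial>gauss I) = 0" if "i \<in> I" for i
      using G.standard_normal_distributed_expectation[OF distributed_gauss_component[OF that]] .
    then show ?thesis
      by (subst Bochner_Integration.integral_sum) (auto intro!: integrable_gauss_component)
  qed
  have max_eq: "max (a + ?L v \<gamma>) (b + ?L v' \<gamma>)
      = ((a + b) + ?L v \<gamma> + ?L v' \<gamma> + \<bar>(a - b) + ?L (\<lambda>i. v i - v' i) \<gamma>\<bar>) / 2" for \<gamma>
    by (simp add: left_diff_distrib sum_subtractf max_def)
  have "(\<integral>\<gamma>. max (a + ?L v \<gamma>) (b + ?L v' \<gamma>) \<partial>gauss I)
      = ((a + b) + (\<integral>\<gamma>. ?L v \<gamma> \<partial>gauss I) + (\<integral>\<gamma>. ?L v' \<gamma> \<partial>gauss I)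
         + (\<integral>\<gamma>. \<bar>(a - b) + ?L (\<lambda>i. v i - v' i) \<gamma>\<bar> \<partial>gauss I)) / 2"
    unfolding max_eq by (simp add: G.prob_space)
  with expectation_abs_shifted_gauss_linear_form[OF assms, of "\<lambda>i. v i - v' i" "a - b"] mean
  show ?thesis by simp
qed

section \<open>From signs to Gaussian variables\<close>

text \<open>
  One sign costs at most one Gaussian vector. The left-hand side is the mean over a random sign of
  \<open>SUP h. (a h + b h) / 2 \<plusminus> (a h - b h) / 2\<close>. It is attained at two indices \<open>h\<close> and \<open>h'\<close>, one for each
  sign, so it only involves one increment of \<open>a - b\<close>. On the right-hand side the maximum over the same
  two indices has at least the mean of the two midpoints plus half the mean absolute value of the
  difference of the two linear forms; \<open>sqrt (pi / 2)\<close> scales the latter to the Euclidean distance.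
\<close>

lemma rademacher_gauss_step:
  fixes a b :: "'h \<Rightarrow> real" and v :: "'h \<Rightarrow> 'i \<Rightarrow> real"
  assumes "finite I" "finite H" "H \<noteq> {}"
    and incr: "\<And>h h'. h \<in> H \<Longrightarrow> h' \<in> H \<Longrightarrow>
      \<bar>(a h - b h) - (a h' - b h')\<bar> \<le> 2 * sqrt (\<Sum>i\<in>I. (v h i - v h' i)\<^sup>2)"
  shows "((SUP h\<in>H. a h) + (SUP h\<in>H. b h)) / 2
       \<le> (\<integral>\<gamma>. (SUP h\<in>H. (a h + b h) / 2 + (\<Sum>i\<in>I. sqrt (pi / 2) * v h i * \<gamma> i)) \<partial>gauss I)"
proof -
  interpret G: prob_space "gauss I" by (rule prob_space_gauss)
  obtain h where h: "h \<in> H" "(SUP h\<in>H. a h) = a h"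
    using finite_SUP_attained assms(2,3) by blast
  obtain h' where h': "h' \<in> H" "(SUP h\<in>H. b h) = b h'"
    using finite_SUP_attained assms(2,3) by blast
  let ?m = "\<lambda>h. (a h + b h) / 2" and ?L = "\<lambda>h \<gamma>. \<Sum>i\<in>I. sqrt (pi / 2) * v h i * \<gamma> i"
  let ?R = "sqrt (\<Sum>i\<in>I. (v h i - v h' i)\<^sup>2)"
  have int: "integrable (gauss I) (\<lambda>\<gamma>. ?m h + ?L h \<gamma>)" for h
    by (intro Bochner_Integration.integrable_add integrable_gauss_linear_form) auto
  have scale: "sqrt (2 / pi) * sqrt (\<Sum>i\<in>I. (sqrt (pi / 2) * v h i - sqrt (pi / 2) * v h' i)\<^sup>2) = ?R"
  proof -
    have "(\<Sum>i\<in>I. (sqrt (pi / 2) * v h i - sqrt (pi / 2) * v h' i)\<^sup>2) = pi / 2 * (\<Sum>i\<in>I. (v h i - v h' i)\<^sup>2)"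
      by (simp add: right_diff_distrib[symmetric] power_mult_distrib sum_distrib_left)
    then show ?thesis by (simp only: real_sqrt_mult[symmetric]) simp
  qed
  have "((SUP h\<in>H. a h) + (SUP h\<in>H. b h)) / 2 = (a h + b h') / 2"
    using h h' by simp
  also have "\<dots> \<le> (?m h + ?m h' + ?R) / 2"
    using incr[OF h(1) h'(1)] by (simp add: abs_le_iff field_simps)
  also have "\<dots> \<le> (\<integral>\<gamma>. max (?m h + ?L h \<gamma>) (?m h' + ?L h' \<gamma>) \<partial>gauss I)"
    using expectation_max_gauss_linear_forms[OF \<open>finite I\<close>, of "?m h" "?m h'"
        "\<lambda>i. sqrt (pi / 2) * v h i" "\<lambda>i. sqrt (pi / 2) * v h' i"] unfolding scale .
  also have "\<dots> \<le> (\<integral>\<gamma>. (SUP h\<in>H. ?m h + ?L h \<gamma>) \<partial>gauss I)"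
    using h(1) h'(1) assms int
    by (intro integral_mono integrable_finite_SUP integrable_max) (auto intro: finite_SUP_upper)
  finally show ?thesis .
qed

text \<open>
  Induction on the dimension of the cube. The step lemma averages out the new coordinate; for each fixed
  value of the Gaussian vector it produces, the induction hypothesis applies to the averaged function
  plus a term that does not depend on \<open>A\<close> and so drops out of all increments. Then the two Gaussian vectors
  are merged.
\<close>

theorem cube_gauss_comparison:
  fixes g :: "'h \<Rightarrow> 'k set \<Rightarrow> real" and v :: "'h \<Rightarrow> 'i \<Rightarrow> real" and c :: "'k \<Rightarrow> 'i \<Rightarrow> real"
  assumes I: "finite I" "I \<noteq> {}" and H: "finite H" "H \<noteq> {}" and K: "finite K"
    and incr: "\<And>k A h h'. k \<in> K \<Longrightarrow> A \<subseteq> K - {k} \<Longrightarrow> h \<in> H \<Longrightarrow> h' \<in> H \<Longrightarrow>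
      \<bar>(g h (insert k A) - g h A) - (g h' (insert k A) - g h' A)\<bar>
        \<le> 2 * sqrt (\<Sum>i\<in>I. (c k i * v h i - c k i * v h' i)\<^sup>2)"
  shows "(\<Sum>A\<in>Pow K. SUP h\<in>H. g h A) / 2 ^ card K
       \<le> (\<integral>\<gamma>. (SUP h\<in>H. (\<Sum>A\<in>Pow K. g h A) / 2 ^ card K
             + (\<Sum>i\<in>I. sqrt (pi / 2) * (sqrt (\<Sum>k\<in>K. (c k i)\<^sup>2) * v h i) * \<gamma> i)) \<partial>gauss I)"
  using K incr
proof (induction K arbitrary: g rule: finite_induct)
  case empty
  interpret G: prob_space "gauss I" by (rule prob_space_gauss)
  show ?case by (simp add: G.prob_space)
next
  case (insert k K)
  interpret G: prob_space "gauss I" by (rule prob_space_gauss)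
  interpret GG: pair_prob_space "gauss I" "gauss I" ..
  define N :: real where "N = 2 ^ card K"
  have N: "N > 0" unfolding N_def by simp
  define m where "m h A = (g h A + g h (insert k A)) / 2" for h A
  define \<xi> where "\<xi> h \<gamma> = (\<Sum>i\<in>I. sqrt (pi / 2) * (c k i * v h i) * \<gamma> i)" for h \<gamma>
  define s where "s i = sqrt (\<Sum>l\<in>K. (c l i)\<^sup>2)" for i
  define \<eta> where "\<eta> h \<gamma> = (\<Sum>i\<in>I. sqrt (pi / 2) * (s i * v h i) * \<gamma> i)" for h \<gamma>
  define r where "r h = (\<Sum>A\<in>Pow K. m h A) / N" for h
  have int_\<xi>: "integrable (gauss I) (\<xi> h)" and int_\<eta>: "integrable (gauss I) (\<eta> h)" for h
    unfolding \<xi>_def \<eta>_def by (intro integrable_gauss_linear_form order.refl)+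

  have Pow_split: "(\<Sum>A\<in>Pow (insert k K). f A) = (\<Sum>A\<in>Pow K. f A + f (insert k A))" for f :: "'k set \<Rightarrow> real"
  proof -
    have "inj_on (insert k) (Pow K)" using insert.hyps by (auto simp: inj_on_def)
    moreover have "Pow K \<inter> insert k ` Pow K = {}" using insert.hyps by auto
    ultimately show ?thesis
      unfolding Pow_insert using insert.hyps
      by (subst sum.union_disjoint) (auto simp: sum.reindex sum.distrib)
  qed
  have N2: "(2::real) ^ card (insert k K) = 2 * N"
    using insert.hyps by (simp add: N_def)
  have r_eq: "(\<Sum>A\<in>Pow (insert k K). g h A) / 2 ^ card (insert k K) = r h" for h
    unfolding Pow_split N2 r_def m_def by (simp add: sum_divide_distrib[symmetric] field_simps)

  have step: "((SUP h\<in>H. g h A) + (SUP h\<in>H. g h (insert k A))) / 2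
           \<le> (\<integral>\<gamma>. (SUP h\<in>H. m h A + \<xi> h \<gamma>) \<partial>gauss I)" if "A \<in> Pow K" for A
    unfolding m_def \<xi>_def
  proof (rule rademacher_gauss_step[OF I(1) H])
    fix h h' assume "h \<in> H" "h' \<in> H"
    then show "\<bar>(g h A - g h (insert k A)) - (g h' A - g h' (insert k A))\<bar>
      \<le> 2 * sqrt (\<Sum>i\<in>I. (c k i * v h i - c k i * v h' i)\<^sup>2)"
      using insert.prems[of k A h h'] insert.hyps that by (auto simp: abs_le_iff)
  qed
  have IH: "(\<Sum>A\<in>Pow K. SUP h\<in>H. m h A + \<xi> h \<gamma>) / N
          \<le> (\<integral>\<gamma>'. (SUP h\<in>H. r h + \<xi> h \<gamma> + \<eta> h \<gamma>') \<partial>gauss I)" for \<gamma>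
  proof -
    have "(\<Sum>A\<in>Pow K. SUP h\<in>H. m h A + \<xi> h \<gamma>) / 2 ^ card K
       \<le> (\<integral>\<gamma>'. (SUP h\<in>H. (\<Sum>A\<in>Pow K. m h A + \<xi> h \<gamma>) / 2 ^ card K
           + (\<Sum>i\<in>I. sqrt (pi / 2) * (sqrt (\<Sum>k\<in>K. (c k i)\<^sup>2) * v h i) * \<gamma>' i)) \<partial>gauss I)"
    proof (rule insert.IH)
      fix l A h h' assume l: "l \<in> K" "A \<subseteq> K - {l}" and hh: "h \<in> H" "h' \<in> H"
      have "\<bar>(g h (insert l A) - g h A) - (g h' (insert l A) - g h' A)\<bar>
          \<le> 2 * sqrt (\<Sum>i\<in>I. (c l i * v h i - c l i * v h' i)\<^sup>2)"
        using l hh by (intro insert.prems) auto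
      moreover have "\<bar>(g h (insert l (insert k A)) - g h (insert k A))
              - (g h' (insert l (insert k A)) - g h' (insert k A))\<bar>
          \<le> 2 * sqrt (\<Sum>i\<in>I. (c l i * v h i - c l i * v h' i)\<^sup>2)"
        using l hh insert.hyps by (intro insert.prems) auto
      ultimately show "\<bar>(m h (insert l A) + \<xi> h \<gamma> - (m h A + \<xi> h \<gamma>))
            - (m h' (insert l A) + \<xi> h' \<gamma> - (m h' A + \<xi> h' \<gamma>))\<bar>
          \<le> 2 * sqrt (\<Sum>i\<in>I. (c l i * v h i - c l i * v h' i)\<^sup>2)"
        unfolding m_def insert_commute[of k l] by (auto simp: abs_le_iff field_simps)
    qed
    moreover have "(\<Sum>A\<in>Pow K. m h A + \<xi> h \<gamma>) / N = r h + \<xi> h \<gamma>" for h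
      using insert.hyps N by (simp add: r_def sum.distrib card_Pow add_divide_distrib N_def)
    ultimately show ?thesis
      unfolding N_def[symmetric] \<eta>_def s_def by simp
  qed
  have int_pair: "integrable (gauss I \<Otimes>\<^sub>M gauss I) (\<lambda>p. SUP h\<in>H. r h + \<xi> h (fst p) + \<eta> h (snd p))"
  proof (intro integrable_finite_SUP[OF H] Bochner_Integration.integrable_add)
    fix h
    show "integrable (gauss I \<Otimes>\<^sub>M gauss I) (\<lambda>p. \<xi> h (fst p))"
      by (rule integrable_comp_fst[OF prob_space_gauss int_\<xi>])
    show "integrable (gauss I \<Otimes>\<^sub>M gauss I) (\<lambda>p. \<eta> h (snd p))"
      by (rule integrable_comp_snd[OF prob_space_gauss prob_space_gauss int_\<eta>])
  qed simp

  have int_SUP: "integrable (gauss I) (\<lambda>\<gamma>. SUP h\<in>H. m h A + \<xi> h \<gamma>)" for A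
    by (intro integrable_finite_SUP[OF H] Bochner_Integration.integrable_add int_\<xi>) simp
  have merge: "\<xi> h \<gamma> + \<eta> h \<gamma>'
      = (\<Sum>i\<in>I. (\<lambda>i\<in>I. c k i * \<gamma> i + s i * \<gamma>' i) i * (sqrt (pi / 2) * v h i))" for h \<gamma> \<gamma>'
    unfolding \<xi>_def \<eta>_def sum.distrib[symmetric]
    by (intro sum.cong refl) (simp only: restrict_apply' algebra_simps)
  have weights: "(\<Sum>i\<in>I. (\<lambda>i\<in>I. sqrt ((c k i)\<^sup>2 + (s i)\<^sup>2) * \<gamma> i) i * (sqrt (pi / 2) * v h i))
      = (\<Sum>i\<in>I. sqrt (pi / 2) * (sqrt (\<Sum>k\<in>insert k K. (c k i)\<^sup>2) * v h i) * \<gamma> i)" for h \<gamma>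
  proof (intro sum.cong refl)
    fix i assume "i \<in> I"
    moreover have "(c k i)\<^sup>2 + (s i)\<^sup>2 = (\<Sum>k\<in>insert k K. (c k i)\<^sup>2)"
      using insert.hyps by (simp add: s_def sum_nonneg)
    ultimately show "(\<lambda>i\<in>I. sqrt ((c k i)\<^sup>2 + (s i)\<^sup>2) * \<gamma> i) i * (sqrt (pi / 2) * v h i)
        = sqrt (pi / 2) * (sqrt (\<Sum>k\<in>insert k K. (c k i)\<^sup>2) * v h i) * \<gamma> i"
      by (simp only: restrict_apply' ac_simps)
  qed

  have "(\<Sum>A\<in>Pow (insert k K). SUP h\<in>H. g h A) / 2 ^ card (insert k K)
      = (\<Sum>A\<in>Pow K. ((SUP h\<in>H. g h A) + (SUP h\<in>H. g h (insert k A))) / 2) / N"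
    unfolding Pow_split N2 by (simp add: sum_divide_distrib[symmetric])
  also have "\<dots> \<le> (\<Sum>A\<in>Pow K. \<integral>\<gamma>. (SUP h\<in>H. m h A + \<xi> h \<gamma>) \<partial>gauss I) / N"
    using N by (intro divide_right_mono sum_mono step) auto
  also have "\<dots> = (\<integral>\<gamma>. (\<Sum>A\<in>Pow K. SUP h\<in>H. m h A + \<xi> h \<gamma>) / N \<partial>gauss I)"
    by (simp add: int_SUP)
  also have "\<dots> \<le> (\<integral>\<gamma>. (\<integral>\<gamma>'. (SUP h\<in>H. r h + \<xi> h \<gamma> + \<eta> h \<gamma>') \<partial>gauss I) \<partial>gauss I)"
  proof (intro integral_mono IH)
    show "integrable (gauss I) (\<lambda>\<gamma>. (\<Sum>A\<in>Pow K. SUP h\<in>H. m h A + \<xi> h \<gamma>) / N)"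
      by (simp add: int_SUP)
    show "integrable (gauss I) (\<lambda>\<gamma>. \<integral>\<gamma>'. (SUP h\<in>H. r h + \<xi> h \<gamma> + \<eta> h \<gamma>') \<partial>gauss I)"
      using GG.integrable_fst'[OF int_pair] by simp
  qed
  also have "\<dots> = (\<integral>p. (SUP h\<in>H. r h + \<xi> h (fst p) + \<eta> h (snd p)) \<partial>(gauss I \<Otimes>\<^sub>M gauss I))"
    using GG.integral_fst'[OF int_pair] by simp
  also have "\<dots> = (\<integral>p. (SUP h\<in>H. r h + (\<Sum>i\<in>I. (\<lambda>i\<in>I. c k i * fst p i + s i * snd p i) i * (sqrt (pi / 2) * v h i)))
                    \<partial>(gauss I \<Otimes>\<^sub>M gauss I))"
    by (simp only: add.assoc merge)
  also have "\<dots> = (\<integral>\<gamma>. (SUP h\<in>H. r h + (\<Sum>i\<in>I. (\<lambda>i\<in>I. sqrt ((c k i)\<^sup>2 + (s i)\<^sup>2) * \<gamma> i) i * (sqrt (pi / 2) * v h i)))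
                    \<partial>gauss I)"
    by (rule expectation_gauss_rotation[OF I])
       (intro borel_measurable_finite_SUP[OF H(1)] borel_measurable_add borel_measurable_const
          borel_measurable_sum borel_measurable_times measurable_component_singleton)
  also have "\<dots> = (\<integral>\<gamma>. (SUP h\<in>H. r h + (\<Sum>i\<in>I. sqrt (pi / 2) * (sqrt (\<Sum>k\<in>insert k K. (c k i)\<^sup>2) * v h i) * \<gamma> i)) \<partial>gauss I)"
    by (simp only: weights)
  finally show ?case unfolding r_eq .
qed

section \<open>Functions of bounded interaction\<close>

text \<open>
  Move from \<open>x\<close> to \<open>x'\<close> by changing one coordinate of \<open>L\<close> at a time.
\<close>

lemma telescoping_bound:
  fixes \<phi> :: "('k \<Rightarrow> 'z) \<Rightarrow> real"
  assumes "finite L" "L \<subseteq> K"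
    and d: "\<And>k x y y'. k \<in> L \<Longrightarrow> x \<in> Pi\<^sub>E K U \<Longrightarrow> y \<in> U k \<Longrightarrow> y' \<in> U k \<Longrightarrow>
          \<bar>\<phi> (x(k := y)) - \<phi> (x(k := y'))\<bar> \<le> d k y y'"
    and "x \<in> Pi\<^sub>E K U" "x' \<in> Pi\<^sub>E K U" and "\<And>k. k \<in> K - L \<Longrightarrow> x k = x' k"
  shows "\<bar>\<phi> x - \<phi> x'\<bar> \<le> (\<Sum>k\<in>L. d k (x k) (x' k))"
  using assms
proof (induction L arbitrary: x' rule: finite_induct)
  case empty
  then have "x = x'" by (intro PiE_ext[of x K U x']) auto
  then show ?case by simp
next
  case (insert l L)
  let ?y = "x'(l := x l)"
  have l: "l \<in> K" using insert.prems by auto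
  have y: "?y \<in> Pi\<^sub>E K U"
    using insert.prems(3,4) l by (auto simp: PiE_iff extensional_def)
  have "\<bar>\<phi> x - \<phi> ?y\<bar> \<le> (\<Sum>k\<in>L. d k (x k) (?y k))"
    using insert.prems y by (intro insert.IH) auto
  also have "\<dots> = (\<Sum>k\<in>L. d k (x k) (x' k))"
    using insert.hyps by (intro sum.cong) auto
  finally have "\<bar>\<phi> x - \<phi> ?y\<bar> \<le> (\<Sum>k\<in>L. d k (x k) (x' k))" .
  moreover have "\<bar>\<phi> ?y - \<phi> (x'(l := x' l))\<bar> \<le> d l (x l) (x' l)"
    using insert.prems l by (intro insert.prems(2)) (auto dest: PiE_mem)
  ultimately show ?case using insert.hyps by simp
qed

lemma partial_diff_commute:
  assumes "k \<noteq> l"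
  shows "partial_diff l z z' (partial_diff k y y' f) x = partial_diff k y y' (partial_diff l z z' f) x"
  using assms by (simp add: partial_diff_def fun_upd_twist)

text \<open>
  The two substituted points move at the cost of the first order constant. For the background vector,
  a change of coordinate \<open>l \<noteq> k\<close> is a second order difference; by commutation the Lipschitz condition
  may be taken in the coordinate \<open>l\<close>, while the points substituted at \<open>k\<close> are arbitrary. The coordinate
  \<open>k\<close> of the background is overwritten.
\<close>

lemma partial_diff_variation:
  fixes f :: "(nat \<Rightarrow> 'z :: real_normed_vector) \<Rightarrow> real" and U :: "'z set" and m j :: real
  defines "V \<equiv> \<lambda>K. K \<rightarrow>\<^sub>E U"
  assumes K: "finite K"
    and lip: "\<And>k x y y'. k \<in> K \<Longrightarrow> x \<in> V K \<Longrightarrow> y \<in> U \<Longrightarrow> y' \<in> U \<Longrightarrow>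
          \<bar>partial_diff k y y' f x\<bar> \<le> m * norm (y - y')"
    and mixed: "\<And>k l x y y' z z'. k \<in> K \<Longrightarrow> l \<in> K \<Longrightarrow> k \<noteq> l \<Longrightarrow> x \<in> V K \<Longrightarrow>
          y \<in> U \<Longrightarrow> y' \<in> U \<Longrightarrow> z \<in> U \<Longrightarrow> z' \<in> U \<Longrightarrow>
          \<bar>partial_diff l z z' (partial_diff k y y' f) x\<bar> \<le> j * norm (y - y')"
    and "0 \<le> j" and k: "k \<in> K" and x: "x \<in> V K" "x' \<in> V K"
    and y: "y \<in> U" "y' \<in> U" "z \<in> U" "z' \<in> U"
  shows "\<bar>partial_diff k y z f x - partial_diff k y' z' f x'\<bar>
       \<le> m * (norm (y - y') + norm (z - z')) + j * (\<Sum>l\<in>K. norm (x l - x' l))"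
proof -
  have 1: "\<bar>partial_diff k y z f x - partial_diff k y' z' f x\<bar> \<le> m * (norm (y - y') + norm (z - z'))"
  proof -
    have "partial_diff k y z f x - partial_diff k y' z' f x = partial_diff k y y' f x - partial_diff k z z' f x"
      by (simp add: partial_diff_def)
    then show ?thesis
      using lip[OF k x(1) y(1,2)] lip[OF k x(1) y(3,4)] by (simp add: distrib_left)
  qed
  have "\<bar>partial_diff k y' z' f x - partial_diff k y' z' f x'\<bar>
      \<le> (\<Sum>l\<in>K. if l = k then 0 else j * norm (x l - x' l))"
  proof (rule telescoping_bound[where K = K and U = "\<lambda>_. U"])
    fix l w s s' assume l: "l \<in> K" "w \<in> K \<rightarrow>\<^sub>E U" "s \<in> U" "s' \<in> U"
    show "\<bar>partial_diff k y' z' f (w(l := s)) - partial_diff k y' z' f (w(l := s'))\<bar>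
        \<le> (if l = k then 0 else j * norm (s - s'))"
    proof (cases "l = k")
      case True
      then show ?thesis by (simp add: partial_diff_def)
    next
      case False
      have "partial_diff k y' z' f (w(l := s)) - partial_diff k y' z' f (w(l := s'))
          = partial_diff k y' z' (partial_diff l s s' f) w"
        using partial_diff_commute[OF False, of y' z' s s' f w] by (simp add: partial_diff_def)
      then show ?thesis using mixed[of l k w s s' y' z'] l k y False by (simp add: V_def)
    qed
  qed (use K x in \<open>auto simp: V_def\<close>)
  also have "\<dots> \<le> (\<Sum>l\<in>K. j * norm (x l - x' l))"
    using \<open>0 \<le> j\<close> by (intro sum_mono) auto
  finally show ?thesis using 1 by (simp add: sum_distrib_left)
qed

text \<open>
  For \<open>B = K - A\<close> the vectors \<open>mix K A u w\<close> and \<open>mix K B u w\<close> are \<open>u\<close> and \<open>w\<close> with the coordinates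
  in \<open>A\<close> exchanged.
\<close>

definition mix :: "'k set \<Rightarrow> 'k set \<Rightarrow> ('k \<Rightarrow> 'z) \<Rightarrow> ('k \<Rightarrow> 'z) \<Rightarrow> 'k \<Rightarrow> 'z" where
  "mix K A u w = (\<lambda>k\<in>K. if k \<in> A then w k else u k)"

lemma mix_in_PiE: "u \<in> Pi\<^sub>E K U \<Longrightarrow> w \<in> Pi\<^sub>E K U \<Longrightarrow> mix K A u w \<in> Pi\<^sub>E K U"
  by (auto simp: mix_def PiE_iff)

text \<open>
  Moving \<open>k\<close> into \<open>A\<close> makes opposite substitutions at \<open>k\<close> in the two mixtures, which enter \<open>Y\<close> with
  opposite signs, so the increment of \<open>Y\<close> is the sum of the same partial difference at two background
  vectors. Together these use each coordinate of \<open>u\<close> and of \<open>w\<close> exactly once. This is why the bound does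
  not depend on \<open>A\<close>, and why the mixed term is shared between \<open>u\<close> and \<open>w\<close>.
\<close>

lemma mix_swap_variation:
  fixes f :: "(nat \<Rightarrow> 'z :: real_normed_vector) \<Rightarrow> real" and U :: "'z set" and m j :: real
  defines "V \<equiv> \<lambda>K. K \<rightarrow>\<^sub>E U"
    and "Y \<equiv> \<lambda>K u w A. f (mix K A u w) - f (mix K (K - A) u w)"
  assumes K: "finite K"
    and lip: "\<And>k x y y'. k \<in> K \<Longrightarrow> x \<in> V K \<Longrightarrow> y \<in> U \<Longrightarrow> y' \<in> U \<Longrightarrow>
          \<bar>partial_diff k y y' f x\<bar> \<le> m * norm (y - y')"
    and mixed: "\<And>k l x y y' z z'. k \<in> K \<Longrightarrow> l \<in> K \<Longrightarrow> k \<noteq> l \<Longrightarrow> x \<in> V K \<Longrightarrow>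
          y \<in> U \<Longrightarrow> y' \<in> U \<Longrightarrow> z \<in> U \<Longrightarrow> z' \<in> U \<Longrightarrow>
          \<bar>partial_diff l z z' (partial_diff k y y' f) x\<bar> \<le> j * norm (y - y')"
    and "0 \<le> j" and k: "k \<in> K" and A: "A \<subseteq> K - {k}"
    and u: "u \<in> V K" "w \<in> V K" "u' \<in> V K" "w' \<in> V K"
  shows "\<bar>(Y K u w (insert k A) - Y K u w A) - (Y K u' w' (insert k A) - Y K u' w' A)\<bar>
       \<le> 2 * m * (norm (u k - u' k) + norm (w k - w' k))
         + j * (\<Sum>l\<in>K. norm (u l - u' l) + norm (w l - w' l))"
proof -
  have incr: "Y K u w (insert k A) - Y K u w A
      = partial_diff k (w k) (u k) f (mix K A u w) + partial_diff k (w k) (u k) f (mix K (K - A) u w)"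
    for u w
  proof -
    have "mix K (insert k A) u w = (mix K A u w)(k := w k)"
      "mix K A u w = (mix K A u w)(k := u k)"
      "mix K (K - insert k A) u w = (mix K (K - A) u w)(k := u k)"
      "mix K (K - A) u w = (mix K (K - A) u w)(k := w k)"
      using k A by (auto simp: mix_def fun_eq_iff)
    then show ?thesis unfolding Y_def partial_diff_def by simp
  qed
  have mem: "mix K B u w \<in> V K \<and> mix K B u' w' \<in> V K" for B
    using u by (simp add: V_def mix_in_PiE del: PiE_iff)
  have vals: "u k \<in> U" "w k \<in> U" "u' k \<in> U" "w' k \<in> U"
    using u k by (auto simp: V_def)
  have "\<bar>partial_diff k (w k) (u k) f (mix K B u w) - partial_diff k (w' k) (u' k) f (mix K B u' w')\<bar>
      \<le> m * (norm (w k - w' k) + norm (u k - u' k)) + j * (\<Sum>l\<in>K. norm (mix K B u w l - mix K B u' w' l))"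
    for B
    using mem vals k K \<open>0 \<le> j\<close> unfolding V_def
    by (intro partial_diff_variation lip[unfolded V_def] mixed[unfolded V_def]) auto
  from this[of A] this[of "K - A"]
  have "\<bar>(Y K u w (insert k A) - Y K u w A) - (Y K u' w' (insert k A) - Y K u' w' A)\<bar>
      \<le> 2 * m * (norm (u k - u' k) + norm (w k - w' k))
        + j * ((\<Sum>l\<in>K. norm (mix K A u w l - mix K A u' w' l)) + (\<Sum>l\<in>K. norm (mix K (K - A) u w l - mix K (K - A) u' w' l)))"
    unfolding incr by (simp add: algebra_simps abs_le_iff)
  also have "(\<Sum>l\<in>K. norm (mix K A u w l - mix K A u' w' l)) + (\<Sum>l\<in>K. norm (mix K (K - A) u w l - mix K (K - A) u' w' l))
      = (\<Sum>l\<in>K. norm (u l - u' l) + norm (w l - w' l))"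
    unfolding sum.distrib[symmetric] by (intro sum.cong) (auto simp: mix_def)
  finally show ?thesis .
qed

lemma weighted_sum_squared_le:
  fixes q a :: "'i \<Rightarrow> real"
  assumes "\<And>i. i \<in> I \<Longrightarrow> 0 \<le> q i"
  shows "(\<Sum>i\<in>I. q i * a i)\<^sup>2 \<le> (\<Sum>i\<in>I. q i) * (\<Sum>i\<in>I. q i * (a i)\<^sup>2)"
proof -
  have "(\<Sum>i\<in>I. q i * a i) = (\<Sum>i\<in>I. sqrt (q i) * (sqrt (q i) * a i))"
    using assms by (intro sum.cong) (auto simp flip: mult.assoc)
  also have "\<dots>\<^sup>2 \<le> (\<Sum>i\<in>I. (sqrt (q i))\<^sup>2) * (\<Sum>i\<in>I. (sqrt (q i) * a i)\<^sup>2)"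
    by (rule Cauchy_Schwarz_ineq_sum)
  also have "\<dots> = (\<Sum>i\<in>I. q i) * (\<Sum>i\<in>I. q i * (a i)\<^sup>2)"
    using assms by (simp add: power_mult_distrib)
  finally show ?thesis .
qed

text \<open>
  The comparison theorem applied to \<open>Y\<close>, with the pair of configurations \<open>u h\<close>, \<open>w h\<close> written as one
  real vector. The supremum of the resulting Gaussian process is at most the sum of two suprema, one for
  each configuration.
\<close>

theorem symmetrized_gauss_bound:
  fixes f :: "(nat \<Rightarrow> real ^ 'd) \<Rightarrow> real" and U :: "(real ^ 'd) set"
    and u w :: "'h \<Rightarrow> nat \<Rightarrow> real ^ 'd" and m j :: real
  defines "G \<equiv> \<lambda>K H u. \<integral>\<gamma>. (SUP h\<in>H. \<Sum>p\<in>K \<times> UNIV. \<gamma> p * (u h (fst p) $ snd p)) \<partial>gauss (K \<times> UNIV)"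
  assumes K: "finite K" "K \<noteq> {}" and H: "finite H" "H \<noteq> {}"
    and lip: "\<And>k x y y'. k \<in> K \<Longrightarrow> x \<in> K \<rightarrow>\<^sub>E U \<Longrightarrow> y \<in> U \<Longrightarrow> y' \<in> U \<Longrightarrow>
          \<bar>partial_diff k y y' f x\<bar> \<le> m * norm (y - y')"
    and mixed: "\<And>k l x y y' z z'. k \<in> K \<Longrightarrow> l \<in> K \<Longrightarrow> k \<noteq> l \<Longrightarrow> x \<in> K \<rightarrow>\<^sub>E U \<Longrightarrow>
          y \<in> U \<Longrightarrow> y' \<in> U \<Longrightarrow> z \<in> U \<Longrightarrow> z' \<in> U \<Longrightarrow>
          \<bar>partial_diff l z z' (partial_diff k y y' f) x\<bar> \<le> j * norm (y - y')"
    and "0 \<le> m" "0 \<le> j"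
    and u: "\<And>h. h \<in> H \<Longrightarrow> u h \<in> K \<rightarrow>\<^sub>E U" "\<And>h. h \<in> H \<Longrightarrow> w h \<in> K \<rightarrow>\<^sub>E U"
  shows "(\<Sum>A\<in>Pow K. SUP h\<in>H. f (mix K A (u h) (w h)) - f (mix K (K - A) (u h) (w h))) / 2 ^ card K
       \<le> sqrt pi / 2 * (2 * m + card K * j) * (G K H u + G K H w)"
proof -
  define P where "P = K \<times> (UNIV :: 'd set)"
  define I where "I = P \<times> (UNIV :: bool set)"
  \<comment> \<open>\<open>q k l\<close> is the cost of moving coordinate \<open>l\<close> (of \<open>u\<close> or of \<open>w\<close>) in half the increment at \<open>k\<close>; these costs have total \<open>T\<close>.\<close>
  define T where "T = 2 * m + card K * j"
  define q where "q k l = (if l = k then m else 0) + j / 2" for k l :: nat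
  define v where "v h i = (if snd i then u h (fst (fst i)) else w h (fst (fst i))) $ snd (fst i)" for h and i :: "(nat \<times> 'd) \<times> bool"
  define c where "c k i = sqrt (T * q k (fst (fst i)))" for k and i :: "(nat \<times> 'd) \<times> bool"
  define g where "g h A = f (mix K A (u h) (w h)) - f (mix K (K - A) (u h) (w h))" for h A
  have T0: "0 \<le> T" and q0: "0 \<le> q k l" for k l
    using \<open>0 \<le> m\<close> \<open>0 \<le> j\<close> by (auto simp: T_def q_def)
  have c2: "(c k i)\<^sup>2 = T * q k (fst (fst i))" for k i
    using T0 q0 by (simp add: c_def)
  have P: "finite P" "P \<noteq> {}" using K by (auto simp: P_def)
  then have I: "finite I" "I \<noteq> {}" by (auto simp: I_def)

  \<comment> \<open>The row sums give the factor \<open>T\<close> in the Cauchy-Schwarz inequality, the column sums the final variance \<open>T * (T / 2)\<close>.\<close>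
  have sum_q: "(\<Sum>l\<in>K. q k l) = T / 2" "(\<Sum>k\<in>K. q k l) = T / 2" if "k \<in> K" "l \<in> K" for k l
    using K that by (simp_all add: q_def T_def sum.distrib add_divide_distrib)

  have incr: "\<bar>(g h (insert k A) - g h A) - (g h' (insert k A) - g h' A)\<bar>
        \<le> 2 * sqrt (\<Sum>i\<in>I. (c k i * v h i - c k i * v h' i)\<^sup>2)"
    if k: "k \<in> K" "A \<subseteq> K - {k}" and h: "h \<in> H" "h' \<in> H" for k A h h'
  proof -
    define a where "a p = norm ((if snd p then u h (fst p) else w h (fst p)) - (if snd p then u h' (fst p) else w h' (fst p)))"
      for p :: "nat \<times> bool"
    have "\<bar>(g h (insert k A) - g h A) - (g h' (insert k A) - g h' A)\<bar>
        \<le> 2 * m * (norm (u h k - u h' k) + norm (w h k - w h' k))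
         + j * (\<Sum>l\<in>K. norm (u h l - u h' l) + norm (w h l - w h' l))"
      unfolding g_def
      using K(1) lip mixed \<open>0 \<le> j\<close> k u(1)[OF h(1)] u(2)[OF h(1)] u(1)[OF h(2)] u(2)[OF h(2)]
      by (rule mix_swap_variation)
    also have "\<dots> = 2 * (\<Sum>p\<in>K \<times> UNIV. q k (fst p) * a p)"
    proof -
      have "(\<Sum>l\<in>K. q k l * r l) = m * r k + j / 2 * (\<Sum>l\<in>K. r l)" for r
        using K k by (simp add: q_def distrib_right sum.distrib sum_distrib_left if_distrib[of "\<lambda>x. x * _"] cong: if_cong)
      from this[of "\<lambda>l. norm (u h l - u h' l) + norm (w h l - w h' l)"] show ?thesis
        by (simp add: sum_Times_bool a_def distrib_left)
    qed
    also have "(\<Sum>p\<in>K \<times> UNIV. q k (fst p) * a p) \<le> sqrt (\<Sum>i\<in>I. (c k i * v h i - c k i * v h' i)\<^sup>2)"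
    proof (rule real_le_rsqrt)
      have "(\<Sum>p\<in>K \<times> (UNIV::bool set). q k (fst p)) = T"
        unfolding sum_Times_bool using sum_q(1)[OF k(1) k(1)]
        by (simp only: fst_conv sum.distrib)
      then have "(\<Sum>p\<in>K \<times> UNIV. q k (fst p) * a p)\<^sup>2 \<le> T * (\<Sum>p\<in>K \<times> UNIV. q k (fst p) * (a p)\<^sup>2)"
        using weighted_sum_squared_le[of "K \<times> (UNIV::bool set)" "\<lambda>p. q k (fst p)" a] q0 by simp
      also have "\<dots> = (\<Sum>p\<in>K \<times> UNIV. \<Sum>d\<in>UNIV. (c k ((fst p, d), snd p))\<^sup>2 * (v h ((fst p, d), snd p) - v h' ((fst p, d), snd p))\<^sup>2)"
        unfolding sum_distrib_left
      proof (intro sum.cong refl)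
        fix p :: "nat \<times> bool"
        have "(a p)\<^sup>2 = (\<Sum>d\<in>UNIV. (v h ((fst p, d), snd p) - v h' ((fst p, d), snd p))\<^sup>2)"
          unfolding a_def v_def norm_vec_def L2_set_def by (simp add: sum_nonneg)
        then show "T * (q k (fst p) * (a p)\<^sup>2)
          = (\<Sum>d\<in>UNIV. (c k ((fst p, d), snd p))\<^sup>2 * (v h ((fst p, d), snd p) - v h' ((fst p, d), snd p))\<^sup>2)"
          by (simp add: c2 sum_distrib_left mult.assoc)
      qed
      also have "\<dots> = (\<Sum>i\<in>I. (c k i)\<^sup>2 * (v h i - v h' i)\<^sup>2)"
        unfolding sum.cartesian_product
        by (rule sum.reindex_bij_witness[where i = "\<lambda>((l, d), b). ((l, b), d)" and j = "\<lambda>((l, b), d). ((l, d), b)"])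
           (auto simp: I_def P_def)
      also have "\<dots> = (\<Sum>i\<in>I. (c k i * v h i - c k i * v h' i)\<^sup>2)"
        by (simp add: power_mult_distrib flip: right_diff_distrib)
      finally show "(\<Sum>p\<in>K \<times> UNIV. q k (fst p) * a p)\<^sup>2 \<le> \<dots>" .
    qed
    finally show ?thesis by simp
  qed

  \<comment> \<open>\<open>g h\<close> changes sign under complementation.\<close>
  have mean: "(\<Sum>A\<in>Pow K. g h A) = 0" for h
  proof -
    have "(\<Sum>A\<in>Pow K. f (mix K (K - A) (u h) (w h))) = (\<Sum>A\<in>Pow K. f (mix K A (u h) (w h)))"
      by (rule sum.reindex_bij_witness[where i = "\<lambda>A. K - A" and j = "\<lambda>A. K - A"]) (auto simp: double_diff)
    then show ?thesis by (simp add: g_def sum_subtractf)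
  qed
  define C where "C = sqrt pi / 2 * T"
  have C0: "0 \<le> C" using T0 by (simp add: C_def)
  have weight: "sqrt (pi / 2) * (sqrt (\<Sum>k\<in>K. (c k i)\<^sup>2) * v h i) * \<gamma> i = C * (v h i * \<gamma> i)"
    if "i \<in> I" for i h and \<gamma> :: "(nat \<times> 'd) \<times> bool \<Rightarrow> real"
  proof -
    have "(\<Sum>k\<in>K. (c k i)\<^sup>2) = T * (T / 2)"
      unfolding c2 sum_distrib_left[symmetric] using sum_q that K by (force simp: I_def P_def)
    then have "sqrt (pi / 2) * sqrt (\<Sum>k\<in>K. (c k i)\<^sup>2) = sqrt (pi * (T / 2)\<^sup>2)"
      unfolding real_sqrt_mult[symmetric] by (simp add: power2_eq_square)
    also have "\<dots> = C" using T0 by (simp add: real_sqrt_mult C_def)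
    finally show ?thesis by (simp add: mult.assoc[symmetric])
  qed
  define L where "L u h \<gamma> = (\<Sum>p\<in>P. \<gamma> p * (u h (fst p) $ snd p))" for u :: "'h \<Rightarrow> nat \<Rightarrow> real ^ 'd" and h \<gamma>
  have L_int: "integrable (gauss P) (\<lambda>\<gamma>. SUP h\<in>H. L u h \<gamma>)" for u
    unfolding L_def mult.commute[of "\<gamma> p" for \<gamma> :: "nat \<times> 'd \<Rightarrow> real" and p]
    by (intro integrable_finite_SUP[OF H] integrable_gauss_linear_form) auto
  have half_meas: "half P b \<in> measurable (gauss I) (gauss P)" for b
    using measurable_half[of P b "\<lambda>_. std_normal"] by (simp add: I_def)
  have half_law: "distr (gauss I) (gauss P) (half P b) = gauss P" for b
    using distr_doubled_half[of P "\<lambda>_. std_normal" b] prob_space_std_normal by (simp add: I_def)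
  have half_integrable: "integrable (gauss I) (\<lambda>\<gamma>. SUP h\<in>H. L u h (half P b \<gamma>))" for u b
    using L_int by (intro integrable_distr[OF half_meas]) (simp add: half_law)
  have half_integral: "(\<integral>\<gamma>. (SUP h\<in>H. L u h (half P b \<gamma>)) \<partial>gauss I) = G K H u" for u b
  proof -
    have "(\<integral>\<gamma>. (SUP h\<in>H. L u h (half P b \<gamma>)) \<partial>gauss I)
        = (\<integral>\<gamma>. (SUP h\<in>H. L u h \<gamma>) \<partial>distr (gauss I) (gauss P) (half P b))"
      by (rule integral_distr[OF half_meas borel_measurable_integrable[OF L_int], symmetric])
    also have "\<dots> = G K H u"
      unfolding half_law unfolding G_def L_def P_def by (rule refl)
    finally show ?thesis .
  qed
  have sum_eq: "(\<Sum>i\<in>I. C * (v h i * \<gamma> i)) = C * (L u h (half P True \<gamma>) + L w h (half P False \<gamma>))" for h \<gamma>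
  proof -
    have "(\<Sum>i\<in>I. v h i * \<gamma> i) = (\<Sum>p\<in>P. v h (p, True) * \<gamma> (p, True) + v h (p, False) * \<gamma> (p, False))"
      unfolding I_def by (rule sum_Times_bool)
    also have "\<dots> = L u h (half P True \<gamma>) + L w h (half P False \<gamma>)"
      unfolding L_def sum.distrib[symmetric] by (intro sum.cong) (auto simp: v_def half_def)
    finally show ?thesis by (simp only: sum_distrib_left[symmetric])
  qed
  have "(\<Sum>A\<in>Pow K. SUP h\<in>H. g h A) / 2 ^ card K
     \<le> (\<integral>\<gamma>. (SUP h\<in>H. (\<Sum>A\<in>Pow K. g h A) / 2 ^ card K
             + (\<Sum>i\<in>I. sqrt (pi / 2) * (sqrt (\<Sum>k\<in>K. (c k i)\<^sup>2) * v h i) * \<gamma> i)) \<partial>gauss I)"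
    by (rule cube_gauss_comparison[OF I H K(1) incr])
  also have "\<dots> = (\<integral>\<gamma>. (SUP h\<in>H. C * (L u h (half P True \<gamma>) + L w h (half P False \<gamma>))) \<partial>gauss I)"
    by (simp only: mean div_0 add_0 weight sum_eq cong: sum.cong)
  also have "\<dots> \<le> (\<integral>\<gamma>. C * ((SUP h\<in>H. L u h (half P True \<gamma>)) + (SUP h\<in>H. L w h (half P False \<gamma>))) \<partial>gauss I)"
  proof (intro integral_mono)
    show "integrable (gauss I) (\<lambda>\<gamma>. SUP h\<in>H. C * (L u h (half P True \<gamma>) + L w h (half P False \<gamma>)))"
      unfolding sum_eq[symmetric] mult.assoc[symmetric]
      by (intro integrable_finite_SUP[OF H] integrable_gauss_linear_form) auto
    fix \<gamma>
    show "(SUP h\<in>H. C * (L u h (half P True \<gamma>) + L w h (half P False \<gamma>)))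
      \<le> C * ((SUP h\<in>H. L u h (half P True \<gamma>)) + (SUP h\<in>H. L w h (half P False \<gamma>)))"
      using C0 H by (intro cSUP_least mult_left_mono add_mono finite_SUP_upper) auto
  qed (intro integrable_mult_right Bochner_Integration.integrable_add half_integrable)
  also have "\<dots> = C * (G K H u + G K H w)"
    using half_integrable by (simp add: half_integral)
  finally show ?thesis unfolding g_def C_def T_def .
qed

section \<open>Bounded differences\<close>

lemma bounded_differences_bounded:
  fixes \<Phi> :: "('k \<Rightarrow> 'x) \<Rightarrow> real" and c :: real
  assumes K: "finite K"
    and diff: "\<And>k x y y'. k \<in> K \<Longrightarrow> x \<in> space (PiM K \<mu>) \<Longrightarrow> y \<in> space (\<mu> k) \<Longrightarrow> y' \<in> space (\<mu> k) \<Longrightarrow>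
          \<bar>\<Phi> (x(k := y)) - \<Phi> (x(k := y'))\<bar> \<le> c"
    and x: "x \<in> space (PiM K \<mu>)" "x' \<in> space (PiM K \<mu>)"
  shows "\<bar>\<Phi> x - \<Phi> x'\<bar> \<le> card K * c"
proof -
  have "\<bar>\<Phi> x - \<Phi> x'\<bar> \<le> (\<Sum>k\<in>K. c)"
    using K order.refl diff[unfolded space_PiM] x[unfolded space_PiM] by (rule telescoping_bound) auto
  then show ?thesis by simp
qed

lemma bounded_differences_integrable:
  fixes \<Phi> :: "('k \<Rightarrow> 'x) \<Rightarrow> real" and c :: real
  assumes \<mu>: "\<And>k. prob_space (\<mu> k)" and K: "finite K"
    and meas: "\<Phi> \<in> borel_measurable (PiM K \<mu>)"
    and diff: "\<And>k x y y'. k \<in> K \<Longrightarrow> x \<in> space (PiM K \<mu>) \<Longrightarrow> y \<in> space (\<mu> k) \<Longrightarrow> y' \<in> space (\<mu> k) \<Longrightarrow>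
          \<bar>\<Phi> (x(k := y)) - \<Phi> (x(k := y'))\<bar> \<le> c"
  shows "integrable (PiM K \<mu>) \<Phi>"
proof -
  interpret Q: prob_space "PiM K \<mu>" using \<mu> by (rule prob_space_PiM)
  obtain x0 where x0: "x0 \<in> space (PiM K \<mu>)" using Q.not_empty by blast
  show ?thesis
  proof (rule Q.integrable_const_bound[OF _ meas, of "\<bar>\<Phi> x0\<bar> + card K * c"], rule AE_I2)
    fix x assume "x \<in> space (PiM K \<mu>)"
    with K diff have "\<bar>\<Phi> x - \<Phi> x0\<bar> \<le> card K * c"
      using x0 by (rule bounded_differences_bounded)
    then show "norm (\<Phi> x) \<le> \<bar>\<Phi> x0\<bar> + card K * c" by simp
  qed
qed

text \<open>
  Hoeffding's lemma needs an interval that contains the values; a function of oscillation at most \<open>c\<close>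
  takes its values in the interval of length \<open>c\<close> above its infimum.
\<close>

lemma oscillation_mgf:
  fixes g :: "'x \<Rightarrow> real"
  assumes "prob_space M" and g: "g \<in> borel_measurable M"
    and osc: "\<And>y y'. y \<in> space M \<Longrightarrow> y' \<in> space M \<Longrightarrow> \<bar>g y - g y'\<bar> \<le> c" and t: "0 < t"
  shows "(\<integral>\<^sup>+y. exp (t * (g y - (\<integral>y. g y \<partial>M))) \<partial>M) \<le> ennreal (exp (t\<^sup>2 * c\<^sup>2 / 8))"
proof -
  interpret prob_space M by fact
  obtain y0 where y0: "y0 \<in> space M" using not_empty by auto
  define a where "a = (INF y\<in>space M. g y)"
  have bdd: "bdd_below (g ` space M)"
    using osc[OF _ y0] by (intro bdd_belowI2[of _ "g y0 - c"]) (auto simp: abs_le_iff algebra_simps)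
  have "g y \<in> {a..a + c}" if y: "y \<in> space M" for y
  proof -
    have "g y - c \<le> a"
      unfolding a_def using osc[OF y] not_empty by (intro cINF_greatest) (auto simp: abs_le_iff algebra_simps)
    moreover have "a \<le> g y" unfolding a_def using y bdd by (intro cINF_lower)
    ultimately show ?thesis by simp
  qed
  then interpret interval_bounded_random_variable M g a "a + c"
    using g by unfold_locales auto
  show ?thesis using Hoeffdings_lemma_nn_integral[OF t] by simp
qed

text \<open>
  Integrate out one coordinate at a time. For a fixed rest of the vector, Hoeffding's lemma bounds the
  deviation from the partial mean \<open>\<Psi>\<close>, and \<open>\<Psi>\<close> again has bounded differences.
\<close>

theorem bounded_differences_mgf:
  fixes \<Phi> :: "('k \<Rightarrow> 'x) \<Rightarrow> real" and c :: real
  assumes \<mu>: "\<And>k. prob_space (\<mu> k)" and K: "finite K"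
    and meas: "\<Phi> \<in> borel_measurable (PiM K \<mu>)"
    and diff: "\<And>k x y y'. k \<in> K \<Longrightarrow> x \<in> space (PiM K \<mu>) \<Longrightarrow> y \<in> space (\<mu> k) \<Longrightarrow> y' \<in> space (\<mu> k) \<Longrightarrow>
          \<bar>\<Phi> (x(k := y)) - \<Phi> (x(k := y'))\<bar> \<le> c"
    and t: "0 < t"
  shows "(\<integral>\<^sup>+x. exp (t * (\<Phi> x - (\<integral>x. \<Phi> x \<partial>PiM K \<mu>))) \<partial>PiM K \<mu>) \<le> ennreal (exp (card K * (t\<^sup>2 * c\<^sup>2 / 8)))"
  using K meas diff
proof (induction K arbitrary: \<Phi> rule: finite_induct)
  case empty
  then show ?case by (simp add: PiM_empty nn_integral_count_space_finite lebesgue_integral_count_space_finite)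
next
  case (insert k K)
  interpret product_sigma_finite \<mu>
    unfolding product_sigma_finite_def using \<mu> by (auto intro: prob_space_imp_sigma_finite)
  interpret K: prob_space "PiM K \<mu>" using \<mu> by (rule prob_space_PiM)
  interpret k: prob_space "\<mu> k" by (rule \<mu>)
  note meas [measurable] = insert.prems(1)
  define E where "E = (\<integral>x. \<Phi> x \<partial>PiM (insert k K) \<mu>)"
  define \<Psi> where "\<Psi> x = (\<integral>y. \<Phi> (x(k := y)) \<partial>\<mu> k)" for x
  have upd: "x(k := y) \<in> space (PiM (insert k K) \<mu>)" if "x \<in> space (PiM K \<mu>)" "y \<in> space (\<mu> k)" for x y
    using that by (auto simp: space_PiM PiE_iff extensional_def)
  have joint: "(\<lambda>(x, y). \<Phi> (x(k := y))) \<in> borel_measurable (PiM K \<mu> \<Otimes>\<^sub>M \<mu> k)"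
    using measurable_comp[OF measurable_add_dim meas] by (simp add: comp_def split_beta)
  have \<Psi>_meas: "\<Psi> \<in> borel_measurable (PiM K \<mu>)"
    unfolding \<Psi>_def using joint by (rule sigma_finite_measure.borel_measurable_lebesgue_integral[OF prob_space_imp_sigma_finite[OF \<mu>]])
  have sect_meas: "(\<lambda>y. \<Phi> (x(k := y))) \<in> borel_measurable (\<mu> k)" if "x \<in> space (PiM K \<mu>)" for x
    using measurable_compose[OF measurable_Pair1'[OF that] joint] by simp
  have osc: "\<bar>\<Phi> (x(k := y)) - \<Phi> (x(k := y'))\<bar> \<le> c"
    if "x \<in> space (PiM K \<mu>)" "y \<in> space (\<mu> k)" "y' \<in> space (\<mu> k)" for x y y'
    using insert.prems(2)[of k "x(k := y)" y y'] that upd[OF that(1,2)] unfolding fun_upd_upd by blast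
  have sect_int: "integrable (\<mu> k) (\<lambda>y. \<Phi> (x(k := y)))" if x: "x \<in> space (PiM K \<mu>)" for x
  proof -
    obtain y0 where y0: "y0 \<in> space (\<mu> k)" using k.not_empty by auto
    show ?thesis
    proof (rule k.integrable_const_bound[OF _ sect_meas[OF x], of "\<bar>\<Phi> (x(k := y0))\<bar> + c"], rule AE_I2)
      fix y assume "y \<in> space (\<mu> k)"
      from osc[OF x this y0] show "norm (\<Phi> (x(k := y))) \<le> \<bar>\<Phi> (x(k := y0))\<bar> + c" by simp
    qed
  qed
  have "integrable (PiM (insert k K) \<mu>) \<Phi>"
    using \<mu> finite.insertI[OF insert.hyps(1)] insert.prems by (rule bounded_differences_integrable)
  then have E_eq: "E = (\<integral>x. \<Psi> x \<partial>PiM K \<mu>)"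
    unfolding E_def \<Psi>_def using insert.hyps by (rule product_integral_insert[rotated 2])
  have IH: "(\<integral>\<^sup>+x. exp (t * (\<Psi> x - E)) \<partial>PiM K \<mu>) \<le> ennreal (exp (card K * (t\<^sup>2 * c\<^sup>2 / 8)))"
    unfolding E_eq
  proof (rule insert.IH[OF \<Psi>_meas])
    fix l x z z' assume l: "l \<in> K" "x \<in> space (PiM K \<mu>)" "z \<in> space (\<mu> l)" "z' \<in> space (\<mu> l)"
    then have lk: "l \<noteq> k" using insert.hyps by auto
    have mem: "x(l := z) \<in> space (PiM K \<mu>)" "x(l := z') \<in> space (PiM K \<mu>)"
      using l by (auto simp: space_PiM PiE_iff extensional_def)
    have "\<Psi> (x(l := z)) - \<Psi> (x(l := z')) = (\<integral>y. \<Phi> (x(l := z, k := y)) - \<Phi> (x(l := z', k := y)) \<partial>\<mu> k)"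
      unfolding \<Psi>_def by (rule Bochner_Integration.integral_diff[OF sect_int[OF mem(1)] sect_int[OF mem(2)], symmetric])
    also have "\<bar>\<dots>\<bar> \<le> (\<integral>y. \<bar>\<Phi> (x(l := z, k := y)) - \<Phi> (x(l := z', k := y))\<bar> \<partial>\<mu> k)"
      by (rule integral_abs_bound)
    also have "\<dots> \<le> (\<integral>y. c \<partial>\<mu> k)"
    proof (rule integral_mono)
      fix y assume "y \<in> space (\<mu> k)"
      then have "\<bar>\<Phi> (x(k := y, l := z)) - \<Phi> (x(k := y, l := z'))\<bar> \<le> c"
        using l by (intro insert.prems(2) upd insertI2)
      then show "\<bar>\<Phi> (x(l := z, k := y)) - \<Phi> (x(l := z', k := y))\<bar> \<le> c"
        by (simp only: fun_upd_twist[OF lk])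
    next
      show "integrable (\<mu> k) (\<lambda>y. \<bar>\<Phi> (x(l := z, k := y)) - \<Phi> (x(l := z', k := y))\<bar>)"
        by (rule integrable_abs[OF Bochner_Integration.integrable_diff[OF sect_int[OF mem(1)] sect_int[OF mem(2)]]])
      show "integrable (\<mu> k) (\<lambda>y. c)" by (rule k.integrable_const)
    qed
    also have "\<dots> = c" by (simp add: k.prob_space)
    finally show "\<bar>\<Psi> (x(l := z)) - \<Psi> (x(l := z'))\<bar> \<le> c" .
  qed
  have "(\<integral>\<^sup>+x. exp (t * (\<Phi> x - E)) \<partial>PiM (insert k K) \<mu>)
      = (\<integral>\<^sup>+x. (\<integral>\<^sup>+y. exp (t * (\<Phi> (x(k := y)) - E)) \<partial>\<mu> k) \<partial>PiM K \<mu>)"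
    using insert.hyps by (intro product_nn_integral_insert) auto
  also have "\<dots> \<le> (\<integral>\<^sup>+x. ennreal (exp (t * (\<Psi> x - E))) * ennreal (exp (t\<^sup>2 * c\<^sup>2 / 8)) \<partial>PiM K \<mu>)"
  proof (rule nn_integral_mono)
    fix x assume x: "x \<in> space (PiM K \<mu>)"
    have exp_meas: "(\<lambda>y. ennreal (exp (t * (g y - \<Psi> x)))) \<in> borel_measurable (\<mu> k)"
      if "g \<in> borel_measurable (\<mu> k)" for g
      using that by measurable
    have "(\<integral>\<^sup>+y. exp (t * (\<Phi> (x(k := y)) - E)) \<partial>\<mu> k)
        = (\<integral>\<^sup>+y. ennreal (exp (t * (\<Psi> x - E))) * ennreal (exp (t * (\<Phi> (x(k := y)) - \<Psi> x))) \<partial>\<mu> k)"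
      by (intro nn_integral_cong) (simp add: ennreal_mult[symmetric] exp_add[symmetric] algebra_simps)
    also have "\<dots> = ennreal (exp (t * (\<Psi> x - E))) * (\<integral>\<^sup>+y. ennreal (exp (t * (\<Phi> (x(k := y)) - \<Psi> x))) \<partial>\<mu> k)"
      by (intro nn_integral_cmult exp_meas sect_meas x)
    also have "\<dots> \<le> ennreal (exp (t * (\<Psi> x - E))) * ennreal (exp (t\<^sup>2 * c\<^sup>2 / 8))"
      unfolding \<Psi>_def by (intro mult_left_mono oscillation_mgf[OF \<mu> sect_meas[OF x] osc[OF x] t]) auto
    finally show "(\<integral>\<^sup>+y. exp (t * (\<Phi> (x(k := y)) - E)) \<partial>\<mu> k) \<le> \<dots>" .
  qed
  also have "\<dots> = (\<integral>\<^sup>+x. ennreal (exp (t * (\<Psi> x - E))) \<partial>PiM K \<mu>) * ennreal (exp (t\<^sup>2 * c\<^sup>2 / 8))"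
    by (intro nn_integral_multc measurable_compose[OF _ measurable_ennreal]
        measurable_compose[OF _ borel_measurable_exp] borel_measurable_times borel_measurable_diff
        borel_measurable_const \<Psi>_meas)
  also have "\<dots> \<le> ennreal (exp (card K * (t\<^sup>2 * c\<^sup>2 / 8))) * ennreal (exp (t\<^sup>2 * c\<^sup>2 / 8))"
    by (intro mult_right_mono IH) auto
  also have "\<dots> = ennreal (exp (card (insert k K) * (t\<^sup>2 * c\<^sup>2 / 8)))"
    using insert.hyps by (simp add: ennreal_mult[symmetric] exp_add[symmetric] algebra_simps)
  finally show ?case unfolding E_def .
qed

text \<open>
  McDiarmid's inequality, with a constant that is weaker by a factor \<open>sqrt 2\<close>.
\<close>

theorem bounded_differences_concentration:
  fixes \<Phi> :: "('k \<Rightarrow> 'x) \<Rightarrow> real" and c :: real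
  assumes \<mu>: "\<And>k. prob_space (\<mu> k)" and K: "finite K" "K \<noteq> {}"
    and meas: "\<Phi> \<in> borel_measurable (PiM K \<mu>)"
    and diff: "\<And>k x y y'. k \<in> K \<Longrightarrow> x \<in> space (PiM K \<mu>) \<Longrightarrow> y \<in> space (\<mu> k) \<Longrightarrow> y' \<in> space (\<mu> k) \<Longrightarrow>
          \<bar>\<Phi> (x(k := y)) - \<Phi> (x(k := y'))\<bar> \<le> c"
    and c: "0 \<le> c" and \<delta>: "0 < \<delta>" "\<delta> < 1"
  shows "measure (PiM K \<mu>) {x \<in> space (PiM K \<mu>). \<Phi> x \<le> (\<integral>x. \<Phi> x \<partial>PiM K \<mu>) + c * sqrt (card K * ln (1 / \<delta>))} \<ge> 1 - \<delta>"
proof -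
  let ?Q = "PiM K \<mu>"
  interpret Q: prob_space ?Q using \<mu> by (rule prob_space_PiM)
  note meas [measurable]
  define E where "E = (\<integral>x. \<Phi> x \<partial>?Q)"
  define L where "L = ln (1 / \<delta>)"
  define \<epsilon> where "\<epsilon> = c * sqrt (card K * L)"
  have L: "L > 0" unfolding L_def using \<delta> by simp
  have n: "real (card K) > 0" using K by (simp add: card_gt_0_iff)
  have "Q.prob {x \<in> space ?Q. E + \<epsilon> < \<Phi> x} \<le> \<delta>"
  proof (cases "c = 0")
    case True
    obtain x0 where x0: "x0 \<in> space ?Q" using Q.not_empty by blast
    have const: "\<Phi> x = \<Phi> x0" if "x \<in> space ?Q" for x
    proof -
      have "\<bar>\<Phi> x - \<Phi> x0\<bar> \<le> card K * c"
        using K(1) diff that x0 by (rule bounded_differences_bounded)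
      then show ?thesis using True by simp
    qed
    have "E = (\<integral>x. \<Phi> x0 \<partial>?Q)"
      unfolding E_def using const by (intro Bochner_Integration.integral_cong) auto
    then have "E = \<Phi> x0" by (simp add: Q.prob_space)
    then have "{x \<in> space ?Q. E + \<epsilon> < \<Phi> x} = {}"
      using const True by (auto simp: \<epsilon>_def)
    then show ?thesis using \<delta> by (simp only: measure_empty)
  next
    case False
    then have c0: "c > 0" using c by simp
    have \<epsilon>0: "\<epsilon> > 0" unfolding \<epsilon>_def using c0 n L by simp
    \<comment> \<open>This \<open>t\<close> minimizes \<open>card K * (t\<^sup>2 * c\<^sup>2 / 8) - t * \<epsilon>\<close>.\<close>
    define t where "t = 4 * \<epsilon> / (card K * c\<^sup>2)"
    have t0: "t > 0" unfolding t_def using \<epsilon>0 n c0 by simp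
    have "ennreal (Q.prob {x \<in> space ?Q. E + \<epsilon> < \<Phi> x}) \<le> emeasure ?Q {x \<in> space ?Q. \<Phi> x - E \<ge> \<epsilon>}"
      unfolding Q.emeasure_eq_measure[symmetric] by (intro emeasure_mono) auto
    also have "\<dots> \<le> ennreal (exp (- t * \<epsilon>)) * (\<integral>\<^sup>+x\<in>space ?Q. exp (t * (\<Phi> x - E)) \<partial>?Q)"
      by (intro Chernoff_ineq_nn_integral_ge t0) auto
    also have "(\<integral>\<^sup>+x\<in>space ?Q. exp (t * (\<Phi> x - E)) \<partial>?Q) = (\<integral>\<^sup>+x. exp (t * (\<Phi> x - E)) \<partial>?Q)"
      by (intro nn_integral_cong) auto
    also have "ennreal (exp (- t * \<epsilon>)) * \<dots> \<le> ennreal (exp (- t * \<epsilon>)) * ennreal (exp (card K * (t\<^sup>2 * c\<^sup>2 / 8)))"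
      unfolding E_def using \<mu> K(1) meas diff t0 by (intro mult_left_mono bounded_differences_mgf) (assumption | simp)+
    also have "\<dots> = ennreal (exp (card K * (t\<^sup>2 * c\<^sup>2 / 8) - t * \<epsilon>))"
      by (simp add: ennreal_mult[symmetric] exp_add[symmetric])
    also have "card K * (t\<^sup>2 * c\<^sup>2 / 8) - t * \<epsilon> = - 2 * (\<epsilon>\<^sup>2 / (card K * c\<^sup>2))"
      unfolding t_def using n c0 by (simp add: field_simps power2_eq_square)
    also have "\<epsilon>\<^sup>2 / (card K * c\<^sup>2) = L"
      unfolding \<epsilon>_def using n c0 L by (simp add: power_mult_distrib field_simps)
    also have "exp (- 2 * L) \<le> exp (- L)" using L by simp
    also have "exp (- L) = \<delta>" using \<delta> by (simp add: L_def ln_div)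
    finally show ?thesis using \<delta> by (simp add: ennreal_leI)
  qed
  moreover have "Q.prob {x \<in> space ?Q. \<Phi> x \<le> E + \<epsilon>} = 1 - Q.prob {x \<in> space ?Q. E + \<epsilon> < \<Phi> x}"
  proof -
    have "{x \<in> space ?Q. \<Phi> x \<le> E + \<epsilon>} = space ?Q - {x \<in> space ?Q. E + \<epsilon> < \<Phi> x}" by auto
    then show ?thesis by (simp add: Q.prob_compl)
  qed
  ultimately show ?thesis unfolding E_def \<epsilon>_def L_def by simp
qed

section \<open>Symmetrization\<close>

lemma measurable_mix:
  "(\<lambda>p. mix K A (fst p) (snd p)) \<in> measurable (PiM K \<mu> \<Otimes>\<^sub>M PiM K \<mu>) (PiM K \<mu>)"
  unfolding mix_def
proof (rule measurable_restrict)
  fix k assume "k \<in> K"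
  then have "(\<lambda>p. fst p k) \<in> measurable (PiM K \<mu> \<Otimes>\<^sub>M PiM K \<mu>) (\<mu> k)"
    "(\<lambda>p. snd p k) \<in> measurable (PiM K \<mu> \<Otimes>\<^sub>M PiM K \<mu>) (\<mu> k)"
    using measurable_compose[OF measurable_fst measurable_component_singleton[of k K \<mu>]]
      measurable_compose[OF measurable_snd measurable_component_singleton[of k K \<mu>]] by auto
  then show "(\<lambda>p. if k \<in> A then snd p k else fst p k) \<in> measurable (PiM K \<mu> \<Otimes>\<^sub>M PiM K \<mu>) (\<mu> k)"
    by (cases "k \<in> A") simp_all
qed

lemma measurable_mix_pair:
  "(\<lambda>p. (mix K A (fst p) (snd p), mix K B (fst p) (snd p)))
    \<in> measurable (PiM K \<mu> \<Otimes>\<^sub>M PiM K \<mu>) (PiM K \<mu> \<Otimes>\<^sub>M PiM K \<mu>)"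
  by (intro measurable_Pair measurable_mix)

text \<open>
  In the doubled product space the exchange of the coordinates in \<open>A\<close> is a permutation \<open>s\<close> of the
  indices that preserves the factors.
\<close>

lemma distr_mix_pair:
  assumes \<mu>: "\<And>k. prob_space (\<mu> k)"
  shows "distr (PiM K \<mu> \<Otimes>\<^sub>M PiM K \<mu>) (PiM K \<mu> \<Otimes>\<^sub>M PiM K \<mu>)
           (\<lambda>p. (mix K A (fst p) (snd p), mix K (K - A) (fst p) (snd p)))
       = PiM K \<mu> \<Otimes>\<^sub>M PiM K \<mu>"
proof -
  let ?QQ = "PiM K \<mu> \<Otimes>\<^sub>M PiM K \<mu>" and ?N = "doubled K \<mu>"
  let ?h = "\<lambda>\<omega>. (half K True \<omega>, half K False \<omega>)"
  let ?T = "\<lambda>p. (mix K A (fst p) (snd p), mix K (K - A) (fst p) (snd p))"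
  define s where "s i = (fst i, if fst i \<in> A then \<not> snd i else snd i)" for i :: "'a \<times> bool"
  let ?S = "\<lambda>\<omega>. \<lambda>i\<in>K \<times> UNIV. \<omega> (s i)"
  have fst_s: "fst (s i) = fst i" for i by (simp add: s_def)
  have s_mem: "s \<in> K \<times> UNIV \<rightarrow> K \<times> UNIV" by (auto simp: s_def)
  have inj: "inj_on s (K \<times> UNIV)" by (auto simp: inj_on_def s_def split: if_splits)
  have S: "distr ?N ?N ?S = ?N"
    using distr_PiM_reindex[of "K \<times> UNIV" "\<lambda>i. \<mu> (fst i)", OF \<mu> inj s_mem] unfolding fst_s .
  have S_meas: "?S \<in> measurable ?N ?N"
  proof (rule measurable_restrict)
    fix i :: "'a \<times> bool" assume "i \<in> K \<times> UNIV"
    then have "s i \<in> K \<times> UNIV" using s_mem by auto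
    from measurable_component_singleton[OF this, of "\<lambda>i. \<mu> (fst i)"]
    show "(\<lambda>\<omega>. \<omega> (s i)) \<in> measurable ?N (\<mu> (fst i))" unfolding fst_s .
  qed
  have h_meas: "?h \<in> measurable ?N ?QQ"
    by (intro measurable_Pair measurable_half)
  have law: "distr ?N ?QQ ?h = ?QQ"
    using \<mu> by (rule distr_doubled_halves)
  have swap: "?T \<circ> ?h = ?h \<circ> ?S"
    by (auto simp: mix_def half_def fun_eq_iff s_def)
  have "distr ?QQ ?QQ ?T = distr (distr ?N ?QQ ?h) ?QQ ?T"
    unfolding law by (rule refl)
  also have "\<dots> = distr ?N ?QQ (?h \<circ> ?S)"
    unfolding swap[symmetric] by (rule distr_distr[OF measurable_mix_pair h_meas])
  also have "\<dots> = distr (distr ?N ?N ?S) ?QQ ?h"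
    by (rule distr_distr[OF h_meas S_meas, symmetric])
  also have "\<dots> = ?QQ"
    unfolding S by (rule law)
  finally show ?thesis .
qed

lemma integral_symmetrize:
  fixes F :: "('k \<Rightarrow> 'x) \<times> ('k \<Rightarrow> 'x) \<Rightarrow> real"
  assumes \<mu>: "\<And>k. prob_space (\<mu> k)" and K: "finite K"
    and F: "integrable (PiM K \<mu> \<Otimes>\<^sub>M PiM K \<mu>) F"
  defines "T \<equiv> \<lambda>A p. (mix K A (fst p) (snd p), mix K (K - A) (fst p) (snd p))"
  shows "integrable (PiM K \<mu> \<Otimes>\<^sub>M PiM K \<mu>) (\<lambda>p. (\<Sum>A\<in>Pow K. F (T A p)) / 2 ^ card K)"
    and "(\<integral>p. (\<Sum>A\<in>Pow K. F (T A p)) / 2 ^ card K \<partial>(PiM K \<mu> \<Otimes>\<^sub>M PiM K \<mu>))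
       = (\<integral>p. F p \<partial>(PiM K \<mu> \<Otimes>\<^sub>M PiM K \<mu>))"
proof -
  let ?QQ = "PiM K \<mu> \<Otimes>\<^sub>M PiM K \<mu>"
  have law: "distr ?QQ ?QQ (T A) = ?QQ" for A
    unfolding T_def using \<mu> by (rule distr_mix_pair)
  have T_meas: "T A \<in> measurable ?QQ ?QQ" for A
    unfolding T_def by (rule measurable_mix_pair)
  have int: "integrable ?QQ (\<lambda>p. F (T A p))" for A
    by (rule integrable_distr[OF T_meas]) (simp add: law F)
  have eq: "(\<integral>p. F (T A p) \<partial>?QQ) = (\<integral>p. F p \<partial>?QQ)" for A
    using integral_distr[OF T_meas borel_measurable_integrable[OF F], of A] unfolding law by (rule sym)
  show "integrable ?QQ (\<lambda>p. (\<Sum>A\<in>Pow K. F (T A p)) / 2 ^ card K)"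
    using int by simp
  show "(\<integral>p. (\<Sum>A\<in>Pow K. F (T A p)) / 2 ^ card K \<partial>?QQ) = (\<integral>p. F p \<partial>?QQ)"
    using int K by (simp add: eq card_Pow)
qed

section \<open>The Gaussian width of a class on a sample\<close>

text \<open>
  The Gaussian average of the values of \<open>H\<close> on the sample \<open>x\<close>, in a form free of the encoding of these
  values as extensional families (see \<open>gaussian_average_eval_class\<close>).
\<close>

definition sample_gauss_width :: "'k set \<Rightarrow> ('x \<Rightarrow> real ^ 'd) set \<Rightarrow> ('k \<Rightarrow> 'x) \<Rightarrow> real" where
  "sample_gauss_width K H x =
    (\<integral>\<gamma>. (SUP h\<in>H. \<Sum>p\<in>K \<times> UNIV. \<gamma> p * (h (x (fst p)) $ snd p)) \<partial>gauss (K \<times> UNIV))"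

text \<open>
  The supremum dominates the maximum of any two linear forms. For \<open>h = h'\<close> this gives nonnegativity; in
  general it shows that the width vanishes only if all members of \<open>H\<close> agree on the sample.
\<close>

lemma sample_gauss_width_lower:
  fixes H :: "('x \<Rightarrow> real ^ 'd) set"
  assumes K: "finite K" and H: "finite H" "h \<in> H" "h' \<in> H"
  shows "sqrt (2 / pi) * sqrt (\<Sum>p\<in>K \<times> UNIV. (h (x (fst p)) $ snd p - h' (x (fst p)) $ snd p)\<^sup>2) / 2
       \<le> sample_gauss_width K H x"
proof -
  let ?v = "\<lambda>h p. h (x (fst p)) $ snd p" and ?P = "K \<times> (UNIV :: 'd set)"
  have fin: "finite ?P" using K by simp
  have ne: "H \<noteq> {}" using H by auto
  have int: "integrable (gauss ?P) (\<lambda>\<gamma>. \<Sum>p\<in>?P. ?v h p * \<gamma> p)" for h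
    by (rule integrable_gauss_linear_form) simp
  have "sqrt (2 / pi) * sqrt (\<Sum>p\<in>?P. (?v h p - ?v h' p)\<^sup>2) / 2
      \<le> (\<integral>\<gamma>. max (0 + (\<Sum>p\<in>?P. ?v h p * \<gamma> p)) (0 + (\<Sum>p\<in>?P. ?v h' p * \<gamma> p)) \<partial>gauss ?P)"
    using expectation_max_gauss_linear_forms[OF fin, of 0 0 "?v h" "?v h'"] unfolding add_0 .
  also have "\<dots> \<le> (\<integral>\<gamma>. (SUP h\<in>H. \<Sum>p\<in>?P. ?v h p * \<gamma> p) \<partial>gauss ?P)"
    unfolding add_0 using int H ne
    by (intro integral_mono integrable_finite_SUP integrable_max max.boundedI
        finite_SUP_upper[where g = "\<lambda>h. \<Sum>p\<in>?P. ?v h p * _ p"])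
  also have "\<dots> = sample_gauss_width K H x"
    unfolding sample_gauss_width_def by (simp only: mult.commute)
  finally show ?thesis .
qed

lemma sample_gauss_width_nonneg:
  assumes "finite K" "finite H" "H \<noteq> {}"
  shows "0 \<le> sample_gauss_width K H x"
proof -
  obtain h where "h \<in> H" using assms by auto
  from sample_gauss_width_lower[OF assms(1,2) this this, of x] show ?thesis by simp
qed

lemma sample_gauss_width_eq_0_imp:
  assumes "finite K" "finite H" "h \<in> H" "h' \<in> H" "sample_gauss_width K H x = 0" "k \<in> K"
  shows "h (x k) = h' (x k)"
proof -
  let ?d = "\<lambda>p. (h (x (fst p)) $ snd p - h' (x (fst p)) $ snd p)\<^sup>2"
  have "sqrt (2 / pi) * sqrt (sum ?d (K \<times> UNIV)) \<le> 0"
    using sample_gauss_width_lower[OF assms(1-4), of x] assms(5) by simp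
  then have "sum ?d (K \<times> UNIV) \<le> 0"
    using pi_gt_zero by (auto simp: mult_le_0_iff)
  then have "sum ?d (K \<times> UNIV) = 0"
    by (intro antisym sum_nonneg) auto
  then have "?d p = 0" if "p \<in> K \<times> UNIV" for p
    using that assms(1) by (subst (asm) sum_nonneg_eq_0_iff) auto
  from this[of "(k, _)"] show ?thesis
    using assms(6) by (simp add: vec_eq_iff)
qed

lemma borel_measurable_sample_gauss_width:
  fixes H :: "('x \<Rightarrow> real ^ 'd) set"
  assumes H: "finite H" "\<And>h k. h \<in> H \<Longrightarrow> k \<in> K \<Longrightarrow> h \<in> borel_measurable (\<mu> k)"
  shows "sample_gauss_width K H \<in> borel_measurable (PiM K \<mu>)"
proof -
  let ?P = "K \<times> (UNIV :: 'd set)"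
  interpret G: prob_space "gauss ?P" by (rule prob_space_gauss)
  have coord: "(\<lambda>v. v $ d) \<in> borel_measurable borel" for d :: 'd
    by (intro borel_measurable_continuous_onI continuous_intros)
  have "(\<lambda>(x, \<gamma>). SUP h\<in>H. \<Sum>p\<in>?P. \<gamma> p * (h (x (fst p)) $ snd p)) \<in> borel_measurable (PiM K \<mu> \<Otimes>\<^sub>M gauss ?P)"
    unfolding split_beta
  proof (intro borel_measurable_finite_SUP[OF H(1)] borel_measurable_sum borel_measurable_times)
    fix h p assume h: "h \<in> H" and p: "p \<in> ?P"
    show "(\<lambda>q. snd q p) \<in> borel_measurable (PiM K \<mu> \<Otimes>\<^sub>M gauss ?P)"
      using p by (intro measurable_compose[OF measurable_snd] measurable_gauss_component)
    have pK: "fst p \<in> K" using p by auto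
    have "(\<lambda>x. h (x (fst p))) \<in> borel_measurable (PiM K \<mu>)"
      by (rule measurable_compose[OF measurable_component_singleton[OF pK, of \<mu>] H(2)[OF h pK]])
    from measurable_compose[OF measurable_fst measurable_compose[OF this coord]]
    show "(\<lambda>q. h (fst q (fst p)) $ snd p) \<in> borel_measurable (PiM K \<mu> \<Otimes>\<^sub>M gauss ?P)" .
  qed
  then show ?thesis
    unfolding sample_gauss_width_def[abs_def] by (rule G.borel_measurable_lebesgue_integral)
qed

section \<open>The expected supremum\<close>

text \<open>
  On the right the negative part of \<open>f\<close> is cut off inside the integral, which can only increase it.
\<close>

lemma ennreal_integral_le_nn_integral:
  fixes f :: "'a \<Rightarrow> real"
  assumes "integrable M f"
  shows "ennreal (\<integral>x. f x \<partial>M) \<le> (\<integral>\<^sup>+x. ennreal (f x) \<partial>M)"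
proof -
  have "ennreal (\<integral>x. f x \<partial>M) \<le> ennreal (\<integral>x. max 0 (f x) \<partial>M)"
    using assms by (intro ennreal_leI integral_mono) auto
  also have "\<dots> = (\<integral>\<^sup>+x. ennreal (max 0 (f x)) \<partial>M)"
    using assms by (intro nn_integral_eq_integral[symmetric]) auto
  also have "\<dots> = (\<integral>\<^sup>+x. ennreal (f x) \<partial>M)"
    by (intro nn_integral_cong) (simp add: max_def ennreal_neg)
  finally show ?thesis .
qed

text \<open>
  Symmetrization followed by \<open>symmetrized_gauss_bound\<close> for each fixed pair of samples. The right-hand
  side is a nonnegative integral, because the width may fail to be integrable.
\<close>

theorem expected_supremum_bound:
  fixes f :: "(nat \<Rightarrow> real ^ 'd) \<Rightarrow> real" and U :: "(real ^ 'd) set" and H :: "('x \<Rightarrow> real ^ 'd) set"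
    and m j :: real
  defines "hv \<equiv> \<lambda>K h x. (\<lambda>k\<in>K. h (x k))"
  assumes \<mu>: "\<And>k. prob_space (\<mu> k)" and K: "finite K" "K \<noteq> {}" and H: "finite H" "H \<noteq> {}"
    and h_meas: "\<And>h k. h \<in> H \<Longrightarrow> k \<in> K \<Longrightarrow> h \<in> borel_measurable (\<mu> k)"
    and h_U: "\<And>h k x. h \<in> H \<Longrightarrow> k \<in> K \<Longrightarrow> x \<in> space (\<mu> k) \<Longrightarrow> h x \<in> U"
    and f_int: "\<And>h. h \<in> H \<Longrightarrow> integrable (PiM K \<mu>) (\<lambda>x. f (hv K h x))"
    and lip: "\<And>k x y y'. k \<in> K \<Longrightarrow> x \<in> K \<rightarrow>\<^sub>E U \<Longrightarrow> y \<in> U \<Longrightarrow> y' \<in> U \<Longrightarrow>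
          \<bar>partial_diff k y y' f x\<bar> \<le> m * norm (y - y')"
    and mixed: "\<And>k l x y y' z z'. k \<in> K \<Longrightarrow> l \<in> K \<Longrightarrow> k \<noteq> l \<Longrightarrow> x \<in> K \<rightarrow>\<^sub>E U \<Longrightarrow>
          y \<in> U \<Longrightarrow> y' \<in> U \<Longrightarrow> z \<in> U \<Longrightarrow> z' \<in> U \<Longrightarrow>
          \<bar>partial_diff l z z' (partial_diff k y y' f) x\<bar> \<le> j * norm (y - y')"
    and mj: "0 \<le> m" "0 \<le> j"
  shows "ennreal (\<integral>x. (SUP h\<in>H. (\<integral>x'. f (hv K h x') \<partial>PiM K \<mu>) - f (hv K h x)) \<partial>PiM K \<mu>)
       \<le> ennreal (sqrt pi * (2 * m + card K * j)) * (\<integral>\<^sup>+x. ennreal (sample_gauss_width K H x) \<partial>PiM K \<mu>)"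
proof -
  let ?Q = "PiM K \<mu>"
  let ?g = "sample_gauss_width K H"
  interpret Q: prob_space ?Q using \<mu> by (rule prob_space_PiM)
  interpret QQ: pair_prob_space ?Q ?Q ..
  define e where "e h = (\<integral>x'. f (hv K h x') \<partial>?Q)" for h
  define F where "F p = (SUP h\<in>H. f (hv K h (fst p)) - f (hv K h (snd p)))" for p
  define C where "C = sqrt pi / 2 * (2 * m + card K * j)"
  have C0: "0 \<le> C" using mj by (simp add: C_def)
  have F_int: "integrable (?Q \<Otimes>\<^sub>M ?Q) F"
    unfolding F_def
    by (intro integrable_finite_SUP[OF H] Bochner_Integration.integrable_diff
        integrable_comp_fst[OF Q.prob_space_axioms, where f = "\<lambda>x. f (hv K _ x)"]
        integrable_comp_snd[OF Q.prob_space_axioms Q.prob_space_axioms, where f = "\<lambda>x. f (hv K _ x)"] f_int)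
  have \<Phi>_int: "integrable ?Q (\<lambda>x. SUP h\<in>H. e h - f (hv K h x))"
    by (intro integrable_finite_SUP[OF H] Bochner_Integration.integrable_diff f_int) simp
  have g_meas: "?g \<in> borel_measurable ?Q"
    using H(1) h_meas by (rule borel_measurable_sample_gauss_width)
  have F_sect_int: "integrable ?Q (\<lambda>x. F (x, x'))" for x'
    unfolding F_def fst_conv snd_conv
    by (intro integrable_finite_SUP[OF H] Bochner_Integration.integrable_diff f_int Q.integrable_const)
  have "(\<integral>x. (SUP h\<in>H. e h - f (hv K h x)) \<partial>?Q) \<le> (\<integral>x'. (\<integral>x. F (x, x') \<partial>?Q) \<partial>?Q)"
  proof (rule integral_mono[OF \<Phi>_int])
    show "integrable ?Q (\<lambda>x'. \<integral>x. F (x, x') \<partial>?Q)"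
      using QQ.integrable_snd[of "\<lambda>x x'. F (x, x')"] F_int by simp
    fix x'
    show "(SUP h\<in>H. e h - f (hv K h x')) \<le> (\<integral>x. F (x, x') \<partial>?Q)"
    proof (rule cSUP_least[OF H(2)])
      fix h assume h: "h \<in> H"
      have "e h - f (hv K h x') = (\<integral>x. f (hv K h x) - f (hv K h x') \<partial>?Q)"
        unfolding e_def using f_int[OF h] by (simp add: Q.prob_space)
      also have "\<dots> \<le> (\<integral>x. F (x, x') \<partial>?Q)"
      proof (rule integral_mono[OF _ F_sect_int])
        show "integrable ?Q (\<lambda>x. f (hv K h x) - f (hv K h x'))"
          using f_int[OF h] by simp
        show "f (hv K h x) - f (hv K h x') \<le> F (x, x')" for x
          unfolding F_def fst_conv snd_conv
          by (rule finite_SUP_upper[OF H(1) h, of "\<lambda>h. f (hv K h x) - f (hv K h x')"])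
      qed
      finally show "e h - f (hv K h x') \<le> (\<integral>x. F (x, x') \<partial>?Q)" .
    qed
  qed
  also have "\<dots> = (\<integral>p. F p \<partial>(?Q \<Otimes>\<^sub>M ?Q))"
    using QQ.integral_snd[of "\<lambda>x x'. F (x, x')"] F_int by simp
  also have "\<dots> = (\<integral>p. (\<Sum>A\<in>Pow K. F (mix K A (fst p) (snd p), mix K (K - A) (fst p) (snd p))) / 2 ^ card K \<partial>(?Q \<Otimes>\<^sub>M ?Q))"
    by (rule integral_symmetrize(2)[OF \<mu> K(1) F_int, symmetric])
  finally have "ennreal (\<integral>x. (SUP h\<in>H. e h - f (hv K h x)) \<partial>?Q)
      \<le> ennreal (\<integral>p. (\<Sum>A\<in>Pow K. F (mix K A (fst p) (snd p), mix K (K - A) (fst p) (snd p))) / 2 ^ card K \<partial>(?Q \<Otimes>\<^sub>M ?Q))"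
    by (rule ennreal_leI)
  also have "\<dots> \<le> (\<integral>\<^sup>+p. ennreal ((\<Sum>A\<in>Pow K. F (mix K A (fst p) (snd p), mix K (K - A) (fst p) (snd p))) / 2 ^ card K) \<partial>(?Q \<Otimes>\<^sub>M ?Q))"
    by (rule ennreal_integral_le_nn_integral[OF integral_symmetrize(1)[OF \<mu> K(1) F_int]])
  also have "\<dots> \<le> (\<integral>\<^sup>+p. ennreal C * (ennreal (?g (fst p)) + ennreal (?g (snd p))) \<partial>(?Q \<Otimes>\<^sub>M ?Q))"
  proof (rule nn_integral_mono)
    fix p assume "p \<in> space (?Q \<Otimes>\<^sub>M ?Q)"
    then have p: "fst p \<in> space ?Q" "snd p \<in> space ?Q" by (auto simp: space_pair_measure)
    have hv_mem: "hv K h x \<in> K \<rightarrow>\<^sub>E U" if "h \<in> H" "x \<in> space ?Q" for h x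
      using that h_U by (auto simp: hv_def space_PiM PiE_iff)
    have hv_mix: "hv K h (mix K A x x') = mix K A (hv K h x) (hv K h x')" for h A x x'
      by (auto simp: hv_def mix_def fun_eq_iff)
    have width: "(\<integral>\<gamma>. (SUP h\<in>H. \<Sum>q\<in>K \<times> UNIV. \<gamma> q * (hv K h x (fst q) $ snd q)) \<partial>gauss (K \<times> UNIV)) = ?g x" for x
    proof -
      have "(\<Sum>q\<in>K \<times> UNIV. \<gamma> q * (hv K h x (fst q) $ snd q)) = (\<Sum>q\<in>K \<times> UNIV. \<gamma> q * (h (x (fst q)) $ snd q))" for h \<gamma>
        by (intro sum.cong) (auto simp: hv_def)
      then show ?thesis unfolding sample_gauss_width_def by (simp only:)
    qed
    have "(\<Sum>A\<in>Pow K. F (mix K A (fst p) (snd p), mix K (K - A) (fst p) (snd p))) / 2 ^ card K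
        \<le> C * (?g (fst p) + ?g (snd p))"
      unfolding F_def fst_conv snd_conv hv_mix C_def width[symmetric]
      using K H lip mixed mj hv_mem[OF _ p(1)] hv_mem[OF _ p(2)]
      by (rule symmetrized_gauss_bound)
    then have "ennreal ((\<Sum>A\<in>Pow K. F (mix K A (fst p) (snd p), mix K (K - A) (fst p) (snd p))) / 2 ^ card K)
        \<le> ennreal (C * (?g (fst p) + ?g (snd p)))" by (rule ennreal_leI)
    also have "\<dots> = ennreal C * (ennreal (?g (fst p)) + ennreal (?g (snd p)))"
      using C0 sample_gauss_width_nonneg[OF K(1) H] by (simp add: ennreal_mult ennreal_plus)
    finally show "ennreal ((\<Sum>A\<in>Pow K. F (mix K A (fst p) (snd p), mix K (K - A) (fst p) (snd p))) / 2 ^ card K) \<le> \<dots>" .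
  qed
  also have "\<dots> = ennreal C * ((\<integral>\<^sup>+x. ennreal (?g x) \<partial>?Q) + (\<integral>\<^sup>+x. ennreal (?g x) \<partial>?Q))"
  proof -
    have g': "(\<lambda>x. ennreal (?g x)) \<in> borel_measurable ?Q"
      using g_meas by (rule measurable_compose[OF _ measurable_ennreal])
    have gf: "(\<lambda>p. ennreal (?g (fst p))) \<in> borel_measurable (?Q \<Otimes>\<^sub>M ?Q)"
      and gs: "(\<lambda>p. ennreal (?g (snd p))) \<in> borel_measurable (?Q \<Otimes>\<^sub>M ?Q)"
      by (rule measurable_compose[OF measurable_fst g'], rule measurable_compose[OF measurable_snd g'])
    have fst_eq: "(\<integral>\<^sup>+p. ennreal (?g (fst p)) \<partial>(?Q \<Otimes>\<^sub>M ?Q)) = (\<integral>\<^sup>+x. ennreal (?g x) \<partial>?Q)"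
      unfolding Q.nn_integral_fst[OF gf, symmetric] fst_conv by (simp only: nn_integral_const Q.emeasure_space_1 mult_1_right)
    have snd_eq: "(\<integral>\<^sup>+p. ennreal (?g (snd p)) \<partial>(?Q \<Otimes>\<^sub>M ?Q)) = (\<integral>\<^sup>+x. ennreal (?g x) \<partial>?Q)"
      unfolding Q.nn_integral_fst[OF gs, symmetric] snd_conv by (simp only: nn_integral_const Q.emeasure_space_1 mult_1_right)
    show ?thesis
      unfolding nn_integral_cmult[OF borel_measurable_add[OF gf gs]] nn_integral_add[OF gf gs] fst_eq snd_eq
      by (rule refl)
  qed
  also have "\<dots> = ennreal (2 * C) * (\<integral>\<^sup>+x. ennreal (?g x) \<partial>?Q)"
    using C0 by (simp only: ennreal_mult ennreal_numeral zero_le_numeral mult_2[symmetric] ac_simps)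
  finally show ?thesis unfolding e_def C_def by (simp add: mult.assoc)
qed

section \<open>Suprema of partial differences\<close>

text \<open>
  The suprema are taken over signed quantities and truncated at \<open>0\<close>. Exchanging two arguments changes
  the sign, so when they are finite they bound absolute values.
\<close>

lemma partial_diff_swap: "partial_diff k y' y f x = - partial_diff k y y' f x"
  by (simp add: partial_diff_def)

lemma partial_diff_partial_diff_swap:
  "partial_diff l z z' (partial_diff k y' y f) x = - partial_diff l z z' (partial_diff k y y' f) x"
  by (simp add: partial_diff_def)

lemma M_diff_bound:
  assumes fin: "M_diff n U f < \<infinity>" and k: "k \<in> {1..n}" "x \<in> {1..n} \<rightarrow>\<^sub>E U" and y: "y \<in> U" "y' \<in> U"
  shows "\<bar>partial_diff k y y' f x\<bar> \<le> enn2real (M_diff n U f)"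
proof -
  have "partial_diff k y y' f x \<le> enn2real (M_diff n U f)" if "y \<in> U" "y' \<in> U" for y y'
  proof -
    have "ennreal (partial_diff k y y' f x) \<le> M_diff n U f"
      unfolding M_diff_def using k that by (intro Sup_upper) blast
    also have "M_diff n U f = ennreal (enn2real (M_diff n U f))" using fin by simp
    finally show ?thesis by (subst (asm) ennreal_le_iff) (rule enn2real_nonneg)
  qed
  from this[OF y] this[OF y(2,1)] show ?thesis
    by (simp add: partial_diff_swap[of k y' y] abs_le_iff)
qed

lemma M_Lip_bound:
  assumes fin: "M_Lip n U f < \<infinity>" and k: "k \<in> {1..n}" "x \<in> {1..n} \<rightarrow>\<^sub>E U" and y: "y \<in> U" "y' \<in> U"
  shows "\<bar>partial_diff k y y' f x\<bar> \<le> enn2real (M_Lip n U f) * norm (y - y')"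
proof (cases "y = y'")
  case True
  then show ?thesis by (simp add: partial_diff_def)
next
  case False
  have "partial_diff k y y' f x \<le> enn2real (M_Lip n U f) * norm (y - y')" if "y \<in> U" "y' \<in> U" "y \<noteq> y'" for y y'
  proof -
    have "ennreal (partial_diff k y y' f x / norm (y - y')) \<le> M_Lip n U f"
      unfolding M_Lip_def using k that by (intro Sup_upper) blast
    also have "M_Lip n U f = ennreal (enn2real (M_Lip n U f))" using fin by simp
    finally have "partial_diff k y y' f x / norm (y - y') \<le> enn2real (M_Lip n U f)"
      by (subst (asm) ennreal_le_iff) (rule enn2real_nonneg)
    then show ?thesis using that by (simp add: field_simps)
  qed
  from this[OF y False] this[OF y(2,1) False[symmetric]] show ?thesis
    by (simp add: partial_diff_swap[of k y' y] norm_minus_commute[of y' y] abs_le_iff)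
qed

lemma J_Lip_bound:
  assumes fin: "J_Lip n U f < \<infinity>" and kl: "k \<in> {1..n}" "l \<in> {1..n}" "k \<noteq> l" and x: "x \<in> {1..n} \<rightarrow>\<^sub>E U"
    and y: "y \<in> U" "y' \<in> U" and z: "z \<in> U" "z' \<in> U"
  shows "\<bar>partial_diff l z z' (partial_diff k y y' f) x\<bar> \<le> enn2real (J_Lip n U f) / n * norm (y - y')"
proof (cases "y = y'")
  case True
  then show ?thesis by (simp add: partial_diff_def)
next
  case False
  have n: "real n > 0" using kl by simp
  have "partial_diff l z z' (partial_diff k y y' f) x \<le> enn2real (J_Lip n U f) / n * norm (y - y')"
    if yy: "y \<in> U" "y' \<in> U" "y \<noteq> y'" for y y'
  proof -
    let ?r = "partial_diff l z z' (partial_diff k y y' f) x / norm (y - y')"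
    have "ennreal ?r \<le> Sup {ennreal (partial_diff l z z' (partial_diff k y y' f) x / norm (y - y')) | k l x y y' z z'.
            k \<in> {1..n} \<and> l \<in> {1..n} \<and> k \<noteq> l \<and> x \<in> {1..n} \<rightarrow>\<^sub>E U \<and>
            y \<in> U \<and> y' \<in> U \<and> y \<noteq> y' \<and> z \<in> U \<and> z' \<in> U}"
      using kl x yy z by (intro Sup_upper) blast
    then have "of_nat n * ennreal ?r \<le> J_Lip n U f"
      unfolding J_Lip_def by (rule mult_left_mono) simp
    also have "J_Lip n U f = ennreal (enn2real (J_Lip n U f))" using fin by simp
    also have "of_nat n * ennreal ?r = ennreal (n * ?r)"
      by (simp only: ennreal_mult'[OF of_nat_0_le_iff] ennreal_of_nat_eq_real_of_nat)
    finally have "n * ?r \<le> enn2real (J_Lip n U f)"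
      by (subst (asm) ennreal_le_iff) (rule enn2real_nonneg)
    then show ?thesis using n yy by (simp add: field_simps)
  qed
  from this[OF y False] this[OF y(2,1) False[symmetric]] show ?thesis
    by (simp add: partial_diff_partial_diff_swap[of l z z' k y' y] norm_minus_commute[of y' y] abs_le_iff)
qed

section \<open>Uniform deviation\<close>

lemma gaussian_average_eval_class:
  "gaussian_average ({1..n} \<times> UNIV) (eval_class n H x) = sample_gauss_width {1..n} H x"
proof -
  have "(SUP y\<in>eval_class n H x. \<Sum>i\<in>{1..n} \<times> UNIV. \<gamma> i * y i)
      = (SUP h\<in>H. \<Sum>p\<in>{1..n} \<times> UNIV. \<gamma> p * (h (x (fst p)) $ snd p))" for \<gamma>
  proof -
    have "(\<Sum>i\<in>{1..n} \<times> UNIV. \<gamma> i * stack n (map_vec n h x) i)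
        = (\<Sum>p\<in>{1..n} \<times> UNIV. \<gamma> p * (h (x (fst p)) $ snd p))" for h
      by (intro sum.cong) (auto simp: stack_def map_vec_def)
    then show ?thesis unfolding eval_class_def image_image by (simp only:)
  qed
  then show ?thesis unfolding gaussian_average_def sample_gauss_width_def by (simp only:)
qed

text \<open>
  If the factor \<open>2 * M_Lip n U f + J_Lip n U f\<close> is infinite, the right-hand side is infinite unless the
  expected width is \<open>0\<close>, since \<open>\<infinity> * 0 = 0\<close>. In that case the members of \<open>H\<close> almost surely coincide on
  the sample, so the supremum is a centred variable.
\<close>

lemma expected_supremum_le_gaussian_average:
  fixes f :: "(nat \<Rightarrow> real ^ 'd) \<Rightarrow> real" and U :: "(real ^ 'd) set" and H :: "('x \<Rightarrow> real ^ 'd) set"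
  defines "K \<equiv> \<lambda>n. {1..n}"
  assumes \<mu>: "\<And>k. prob_space (\<mu> k)" and n: "1 \<le> n" and H: "finite H" "H \<noteq> {}"
    and h_meas: "\<And>h k. h \<in> H \<Longrightarrow> k \<in> K n \<Longrightarrow> h \<in> borel_measurable (\<mu> k)"
    and h_U: "\<And>h k x. h \<in> H \<Longrightarrow> k \<in> K n \<Longrightarrow> x \<in> space (\<mu> k) \<Longrightarrow> h x \<in> U"
    and f_int: "\<And>h. h \<in> H \<Longrightarrow> integrable (PiM (K n) \<mu>) (\<lambda>x. f (map_vec n h x))"
  shows "ennreal (\<integral>x. (SUP h\<in>H. (\<integral>x'. f (map_vec n h x') \<partial>PiM (K n) \<mu>) - f (map_vec n h x)) \<partial>PiM (K n) \<mu>)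
       \<le> ennreal (sqrt (2 * pi)) * (2 * M_Lip n U f + J_Lip n U f)
         * (\<integral>\<^sup>+x. ennreal (gaussian_average ({1..n} \<times> UNIV) (eval_class n H x)) \<partial>PiM (K n) \<mu>)"
proof -
  let ?Q = "PiM (K n) \<mu>"
  let ?B = "2 * M_Lip n U f + J_Lip n U f"
  let ?g = "sample_gauss_width (K n) H"
  interpret Q: prob_space ?Q using \<mu> by (rule prob_space_PiM)
  have K: "finite (K n)" "K n \<noteq> {}" using n by (auto simp: K_def)
  have width: "gaussian_average ({1..n} \<times> UNIV) (eval_class n H x) = ?g x" for x
    unfolding K_def by (rule gaussian_average_eval_class)
  have g_meas: "?g \<in> borel_measurable ?Q"
    using H(1) h_meas by (rule borel_measurable_sample_gauss_width)
  define e where "e h = (\<integral>x'. f (map_vec n h x') \<partial>?Q)" for h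
  show ?thesis
  proof (cases "?B < \<infinity>")
    case True
    then have fin: "M_Lip n U f < \<infinity>" "J_Lip n U f < \<infinity>"
      by (auto simp: ennreal_mult_less_top top.not_eq_extremum)
    define m where "m = enn2real (M_Lip n U f)"
    define J where "J = enn2real (J_Lip n U f)"
    have mJ: "M_Lip n U f = ennreal m" "J_Lip n U f = ennreal J" "0 \<le> m" "0 \<le> J"
      using fin by (simp_all add: m_def J_def)
    have lip: "\<bar>partial_diff k y y' f x\<bar> \<le> m * norm (y - y')"
      if "k \<in> K n" "x \<in> K n \<rightarrow>\<^sub>E U" "y \<in> U" "y' \<in> U" for k x y y'
      using M_Lip_bound[OF fin(1)] that unfolding m_def K_def by blast
    have mixed: "\<bar>partial_diff l z z' (partial_diff k y y' f) x\<bar> \<le> J / n * norm (y - y')"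
      if "k \<in> K n" "l \<in> K n" "k \<noteq> l" "x \<in> K n \<rightarrow>\<^sub>E U" "y \<in> U" "y' \<in> U" "z \<in> U" "z' \<in> U" for k l x y y' z z'
      using J_Lip_bound[OF fin(2)] that unfolding J_def K_def by blast
    have Jn: "0 \<le> J / n" using mJ by simp
    have "ennreal (\<integral>x. (SUP h\<in>H. e h - f (map_vec n h x)) \<partial>?Q)
        \<le> ennreal (sqrt pi * (2 * m + card (K n) * (J / n))) * (\<integral>\<^sup>+x. ennreal (?g x) \<partial>?Q)"
      unfolding e_def map_vec_def K_def[symmetric]
      using \<mu> K H h_meas h_U f_int[unfolded map_vec_def, folded K_def] lip mixed mJ(3) Jn
      by (rule expected_supremum_bound)
    also have "sqrt pi * (2 * m + card (K n) * (J / n)) = sqrt pi * (2 * m + J)"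
      using n by (simp add: K_def)
    also have "ennreal (sqrt pi * (2 * m + J)) \<le> ennreal (sqrt (2 * pi)) * ?B"
    proof -
      have "sqrt pi * (2 * m + J) \<le> sqrt (2 * pi) * (2 * m + J)"
        using mJ pi_gt_zero by (intro mult_right_mono) auto
      then have "ennreal (sqrt pi * (2 * m + J)) \<le> ennreal (sqrt (2 * pi) * (2 * m + J))"
        by (rule ennreal_leI)
      also have "\<dots> = ennreal (sqrt (2 * pi)) * ?B"
        unfolding mJ(1,2) using mJ(3,4) by (simp add: ennreal_mult ennreal_plus)
      finally show ?thesis .
    qed
    finally show ?thesis unfolding e_def width by (simp add: mult_right_mono)
  next
    case False
    then have B: "?B = \<infinity>" by (metis infinity_ennreal_def less_top)
    show ?thesis
    proof (cases "(\<integral>\<^sup>+x. ennreal (?g x) \<partial>?Q) = 0")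
      case False
      then have "ennreal (sqrt (2 * pi)) * \<infinity> * (\<integral>\<^sup>+x. ennreal (?g x) \<partial>?Q) = \<infinity>"
        using pi_gt_zero by (simp add: ennreal_mult_eq_top_iff)
      then show ?thesis unfolding width B by simp
    next
      case True
      obtain h0 where h0: "h0 \<in> H" using H by auto
      have "AE x in ?Q. ennreal (?g x) = 0"
        using True nn_integral_0_iff_AE[OF measurable_compose[OF g_meas measurable_ennreal]] by blast
      then have eq: "AE x in ?Q. \<forall>h\<in>H. map_vec n h x = map_vec n h0 x"
      proof eventually_elim
        case (elim x)
        then have 0: "?g x = 0"
          using sample_gauss_width_nonneg[OF K(1) H, of x] by (simp add: ennreal_eq_0_iff)
        show ?case
        proof
          fix h assume "h \<in> H"
          from sample_gauss_width_eq_0_imp[OF K(1) H(1) this h0 0]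
          show "map_vec n h x = map_vec n h0 x" by (auto simp: map_vec_def K_def fun_eq_iff)
        qed
      qed
      have e_eq: "e h = e h0" if "h \<in> H" for h
        unfolding e_def
      proof (rule integral_cong_AE)
        show "AE x in ?Q. f (map_vec n h x) = f (map_vec n h0 x)"
          using eq by eventually_elim (use that in auto)
      qed (intro borel_measurable_integrable f_int h0 that)+
      have "(\<integral>x. (SUP h\<in>H. e h - f (map_vec n h x)) \<partial>?Q) = (\<integral>x. e h0 - f (map_vec n h0 x) \<partial>?Q)"
      proof (rule integral_cong_AE)
        show "AE x in ?Q. (SUP h\<in>H. e h - f (map_vec n h x)) = e h0 - f (map_vec n h0 x)"
          using eq
        proof eventually_elim
          case (elim x)
          obtain h where "h \<in> H" "(SUP h\<in>H. e h - f (map_vec n h x)) = e h - f (map_vec n h x)"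
            using finite_SUP_attained[OF H] by blast
          with elim e_eq show ?case by auto
        qed
        show "(\<lambda>x. SUP h\<in>H. e h - f (map_vec n h x)) \<in> borel_measurable ?Q"
          by (intro borel_measurable_finite_SUP[OF H(1)] borel_measurable_diff borel_measurable_const
              borel_measurable_integrable f_int)
        show "(\<lambda>x. e h0 - f (map_vec n h0 x)) \<in> borel_measurable ?Q"
          by (intro borel_measurable_diff borel_measurable_const borel_measurable_integrable f_int h0)
      qed
      also have "\<dots> = 0"
        using f_int[OF h0] by (simp add: e_def Q.prob_space)
      finally show ?thesis unfolding e_def by simp
    qed
  qed
qed

text \<open>
  Both expectations on the right-hand side and in the supremum involve \<open>X'\<close> only through its law, which
  is the law \<open>PiM K \<mu>\<close> of \<open>X\<close>. So everything can be transported to that product space, where the mean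
  bound and the concentration inequality apply to \<open>\<Phi>\<close>.
\<close>

theorem corollary3:
  fixes P :: "'w measure" and S :: "'x measure"
    and n :: nat
    and X X' :: "nat \<Rightarrow> 'w \<Rightarrow> 'x"
    and U :: "(real ^ 'd) set"
    and H :: "('x \<Rightarrow> real ^ 'd) set"
    and f :: "(nat \<Rightarrow> real ^ 'd) \<Rightarrow> real"
    and \<delta> :: real
  assumes "prob_space P"
    and "n \<ge> 1"
    and "prob_space.indep_vars P (\<lambda>_. S) X {1..n}"
    and "prob_space.indep_var P
           (PiM {1..n} (\<lambda>_. S)) (\<lambda>\<omega>. \<lambda>k\<in>{1..n}. X k \<omega>)
           (PiM {1..n} (\<lambda>_. S)) (\<lambda>\<omega>. \<lambda>k\<in>{1..n}. X' k \<omega>)"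
    and "distr P (PiM {1..n} (\<lambda>_. S)) (\<lambda>\<omega>. \<lambda>k\<in>{1..n}. X' k \<omega>) =
         distr P (PiM {1..n} (\<lambda>_. S)) (\<lambda>\<omega>. \<lambda>k\<in>{1..n}. X k \<omega>)"
    and "finite H"
    and "\<And>h. h \<in> H \<Longrightarrow> h \<in> measurable S (restrict_space borel U)"
    and "f \<in> borel_measurable (PiM {1..n} (\<lambda>_. restrict_space borel U))"
    and "\<And>h. h \<in> H \<Longrightarrow> integrable P (\<lambda>\<omega>. f (map_vec n h (\<lambda>k. X' k \<omega>)))"
    and "0 < \<delta>" and "\<delta> < 1"
  shows "measure P {\<omega> \<in> space P.
           (SUP h\<in>H. ereal ((\<integral>\<omega>'. f (map_vec n h (\<lambda>k. X' k \<omega>')) \<partial>P)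
                             - f (map_vec n h (\<lambda>k. X k \<omega>))))
           \<le> enn2ereal
               (ennreal (sqrt (2 * pi)) * (2 * M_Lip n U f + J_Lip n U f)
                  * (\<integral>\<^sup>+\<omega>'. ennreal (gaussian_average ({1..n} \<times> UNIV)
                                   (eval_class n H (\<lambda>k. X' k \<omega>'))) \<partial>P)
                + M_diff n U f * ennreal (sqrt (real n * ln (1 / \<delta>))))}
         \<ge> 1 - \<delta>"
proof -
  interpret P: prob_space P by fact
  note n = assms(2) and H_fin = assms(6) and \<delta> = assms(10,11)
  define K where "K = {1..n}"
  define R where "R = enn2ereal
               (ennreal (sqrt (2 * pi)) * (2 * M_Lip n U f + J_Lip n U f)
                  * (\<integral>\<^sup>+\<omega>'. ennreal (gaussian_average ({1..n} \<times> UNIV)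
                                   (eval_class n H (\<lambda>k. X' k \<omega>'))) \<partial>P)
                + M_diff n U f * ennreal (sqrt (real n * ln (1 / \<delta>))))"
  define E' where "E' h = (\<integral>\<omega>'. f (map_vec n h (\<lambda>k. X' k \<omega>')) \<partial>P)" for h
  define D where "D \<omega> = (SUP h\<in>H. ereal (E' h - f (map_vec n h (\<lambda>k. X k \<omega>))))" for \<omega>
  have trivial: ?thesis if "\<And>\<omega>. D \<omega> \<le> R"
  proof -
    have "{\<omega> \<in> space P. D \<omega> \<le> R} = space P" using that by auto
    then show ?thesis unfolding D_def E'_def R_def using \<delta> by (simp add: P.prob_space)
  qed
  show ?thesis
  proof (cases "H = {} \<or> M_diff n U f = \<infinity>")
    case True
    then show ?thesis
    proof
      assume "H = {}"
      then show ?thesis by (intro trivial) (simp add: D_def bot_ereal_def)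
    next
      assume "M_diff n U f = \<infinity>"
      moreover have "0 < sqrt (real n * ln (1 / \<delta>))" using n \<delta> by simp
      moreover have "\<infinity> * ennreal s = \<infinity>" if "0 < s" for s
        using that by (simp add: ennreal_top_mult)
      ultimately have "M_diff n U f * ennreal (sqrt (real n * ln (1 / \<delta>))) = \<infinity>" by metis
      then have "R = \<infinity>" unfolding R_def by (simp del: ennreal_mult_eq_top_iff)
      then show ?thesis by (intro trivial) simp
    qed
  next
    case False
    then have H: "finite H" "H \<noteq> {}" and M_fin: "M_diff n U f < \<infinity>"
      using H_fin by (auto simp: top.not_eq_extremum)
    have K: "finite K" "K \<noteq> {}" using n by (auto simp: K_def)
    have X: "X k \<in> measurable P S" if "k \<in> K" for k
      using assms(3) that unfolding P.indep_vars_def K_def by blast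
    \<comment> \<open>Indices outside \<open>K\<close> get the law of \<open>X 1\<close>, so that every \<open>\<mu> k\<close> is a probability measure.\<close>
    define \<mu> where "\<mu> k = distr P S (X (if k \<in> K then k else 1))" for k
    have one: "1 \<in> K" using n by (simp add: K_def)
    have \<mu>: "prob_space (\<mu> k)" for k
      unfolding \<mu>_def using X one by (intro P.prob_space_distr) auto
    let ?Q = "PiM K \<mu>"
    let ?S = "PiM K (\<lambda>_. S)"
    define T where "T \<omega> = (\<lambda>k\<in>K. X k \<omega>)" for \<omega>
    define T' where "T' \<omega> = (\<lambda>k\<in>K. X' k \<omega>)" for \<omega>
    have T: "T \<in> measurable P ?S"
      unfolding T_def by (intro measurable_restrict X)
    have T': "T' \<in> measurable P ?S"
      unfolding T'_def K_def using assms(4) by (rule P.indep_var_rv2)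
    have law: "distr P ?S T = ?Q"
    proof -
      have "distr P ?S T = (\<Pi>\<^sub>M k\<in>K. distr P S (X k))"
        using P.indep_vars_iff_distr_eq_PiM'[of K X "\<lambda>_. S"] K X assms(3) unfolding T_def K_def by blast
      also have "\<dots> = ?Q" by (intro PiM_cong) (auto simp: \<mu>_def)
      finally show ?thesis .
    qed
    have law': "distr P ?S T' = ?Q"
      using assms(5) law unfolding T_def T'_def K_def by simp
    have map_T: "map_vec n h (\<lambda>k. X k \<omega>) = map_vec n h (T \<omega>)"
      "map_vec n h (\<lambda>k. X' k \<omega>) = map_vec n h (T' \<omega>)" for h and \<omega>
      by (auto simp: map_vec_def T_def T'_def K_def fun_eq_iff)
    have \<mu>_space: "space (\<mu> k) = space S" and \<mu>_sets: "sets (\<mu> k) = sets S" for k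
      unfolding \<mu>_def by simp_all
    have h_meas: "h \<in> borel_measurable (\<mu> k)" if "h \<in> H" for h k
      using assms(7)[OF that] unfolding measurable_restrict_space2_iff measurable_cong_sets[OF \<mu>_sets refl] by blast
    have h_U: "h x \<in> U" if "h \<in> H" "x \<in> space (\<mu> k)" for h x k
      using assms(7)[OF that(1)] that(2) unfolding measurable_restrict_space2_iff \<mu>_space by blast
    have map_meas: "(\<lambda>x. f (map_vec n h x)) \<in> borel_measurable ?S" if "h \<in> H" for h
    proof (rule measurable_compose[OF _ assms(8)])
      show "map_vec n h \<in> measurable ?S (\<Pi>\<^sub>M k\<in>{1..n}. restrict_space borel U)"
        unfolding map_vec_def[abs_def] K_def
        by (intro measurable_restrict measurable_compose[OF _ assms(7)[OF that]] measurable_component_singleton)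
    qed
    have f_int: "integrable ?Q (\<lambda>x. f (map_vec n h x))" if "h \<in> H" for h
      using assms(9)[OF that] unfolding law'[symmetric] map_T by (subst integrable_distr_eq[OF T' map_meas[OF that]])
    have E'_eq: "E' h = (\<integral>x. f (map_vec n h x) \<partial>?Q)" if "h \<in> H" for h
      unfolding E'_def law'[symmetric] map_T by (rule integral_distr[OF T' map_meas[OF that], symmetric])

    define \<Phi> where "\<Phi> x = (SUP h\<in>H. E' h - f (map_vec n h x))" for x
    define c where "c = enn2real (M_diff n U f)"
    have c_nonneg: "0 \<le> c" unfolding c_def by (rule enn2real_nonneg)
    have \<Phi>_meas: "\<Phi> \<in> borel_measurable ?Q"
      unfolding \<Phi>_def
      by (intro borel_measurable_finite_SUP[OF H(1)] borel_measurable_diff borel_measurable_const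
          borel_measurable_integrable f_int)
    have \<Phi>_diff: "\<bar>\<Phi> (x(k := y)) - \<Phi> (x(k := y'))\<bar> \<le> c"
      if k: "k \<in> K" "x \<in> space ?Q" "y \<in> space (\<mu> k)" "y' \<in> space (\<mu> k)" for k x y y'
      unfolding \<Phi>_def
    proof (rule finite_SUP_diff_le[OF H])
      fix h assume h: "h \<in> H"
      have upd: "map_vec n h (x(k := y)) = (map_vec n h x)(k := h y)" for y
        using k by (auto simp: map_vec_def K_def fun_eq_iff)
      have "map_vec n h x \<in> {1..n} \<rightarrow>\<^sub>E U"
        using k(2) h_U[OF h] by (auto simp: map_vec_def space_PiM PiE_iff K_def)
      then have "\<bar>partial_diff k (h y') (h y) f (map_vec n h x)\<bar> \<le> c"
        unfolding c_def using k h_U[OF h] by (intro M_diff_bound[OF M_fin]) (auto simp: K_def)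
      then show "\<bar>E' h - f (map_vec n h (x(k := y))) - (E' h - f (map_vec n h (x(k := y'))))\<bar> \<le> c"
        unfolding upd partial_diff_def by simp
    qed
    define \<epsilon> where "\<epsilon> = c * sqrt (card K * ln (1 / \<delta>))"
    have \<epsilon>_nonneg: "0 \<le> \<epsilon>"
      unfolding \<epsilon>_def using c_nonneg \<delta> by simp
    let ?A = "{x \<in> space ?Q. \<Phi> x \<le> (\<integral>x. \<Phi> x \<partial>?Q) + \<epsilon>}"
    have conc: "measure ?Q ?A \<ge> 1 - \<delta>"
      unfolding \<epsilon>_def using \<mu> K \<Phi>_meas \<Phi>_diff c_nonneg \<delta>
      by (rule bounded_differences_concentration)

    have R_bound: "ereal ((\<integral>x. \<Phi> x \<partial>?Q) + \<epsilon>) \<le> R"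
    proof -
      have width: "(\<integral>\<^sup>+\<omega>'. ennreal (gaussian_average ({1..n} \<times> UNIV) (eval_class n H (\<lambda>k. X' k \<omega>'))) \<partial>P)
          = (\<integral>\<^sup>+x. ennreal (gaussian_average ({1..n} \<times> UNIV) (eval_class n H x)) \<partial>?Q)"
      proof -
        have "sample_gauss_width K H \<in> borel_measurable ?Q"
          using H(1) h_meas by (rule borel_measurable_sample_gauss_width)
        then have "(\<lambda>x. ennreal (gaussian_average ({1..n} \<times> UNIV) (eval_class n H x))) \<in> borel_measurable (distr P ?S T')"
          unfolding law' unfolding gaussian_average_eval_class K_def by (rule measurable_compose[OF _ measurable_ennreal])
        then show ?thesis
          unfolding eval_class_def map_T law'[symmetric] by (subst nn_integral_distr[OF T']) auto
      qed
      have mean: "ennreal (\<integral>x. \<Phi> x \<partial>?Q) \<le> ennreal (sqrt (2 * pi)) * (2 * M_Lip n U f + J_Lip n U f)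
         * (\<integral>\<^sup>+x. ennreal (gaussian_average ({1..n} \<times> UNIV) (eval_class n H x)) \<partial>?Q)"
      proof -
        have "\<Phi> x = (SUP h\<in>H. (\<integral>x'. f (map_vec n h x') \<partial>?Q) - f (map_vec n h x))" for x
          unfolding \<Phi>_def using E'_eq by (intro SUP_cong) auto
        then show ?thesis
          using expected_supremum_le_gaussian_average[of \<mu> n H U f, OF \<mu> n H] h_meas h_U f_int
          unfolding K_def by simp
      qed
      have "ennreal ((\<integral>x. \<Phi> x \<partial>?Q) + \<epsilon>) \<le> ennreal (\<integral>x. \<Phi> x \<partial>?Q) + ennreal \<epsilon>"
      proof (cases "0 \<le> (\<integral>x. \<Phi> x \<partial>?Q)")
        case True
        then show ?thesis using \<epsilon>_nonneg by simp
      next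
        case False
        then have "ennreal ((\<integral>x. \<Phi> x \<partial>?Q) + \<epsilon>) \<le> ennreal \<epsilon>" by (intro ennreal_leI) simp
        then show ?thesis by (simp add: add_increasing)
      qed
      also have "ennreal \<epsilon> = M_diff n U f * ennreal (sqrt (real n * ln (1 / \<delta>)))"
      proof -
        have "M_diff n U f = ennreal c" using M_fin by (simp add: c_def)
        then show ?thesis
          unfolding \<epsilon>_def using ennreal_mult'[OF c_nonneg, of "sqrt (n * ln (1 / \<delta>))"] by (simp add: K_def)
      qed
      finally have "ennreal ((\<integral>x. \<Phi> x \<partial>?Q) + \<epsilon>) \<le> ennreal (sqrt (2 * pi)) * (2 * M_Lip n U f + J_Lip n U f)
                  * (\<integral>\<^sup>+\<omega>'. ennreal (gaussian_average ({1..n} \<times> UNIV)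
                                   (eval_class n H (\<lambda>k. X' k \<omega>'))) \<partial>P)
                + M_diff n U f * ennreal (sqrt (real n * ln (1 / \<delta>)))"
        unfolding width using mean by (meson add_right_mono order_trans)
      then have "enn2ereal (ennreal ((\<integral>x. \<Phi> x \<partial>?Q) + \<epsilon>)) \<le> R"
        unfolding R_def by (simp add: less_eq_ennreal.rep_eq)
      moreover have "ereal r \<le> enn2ereal (ennreal r)" for r
        by (cases "0 \<le> r") (auto simp: ennreal_neg enn2ereal_ennreal zero_ennreal.rep_eq)
      ultimately show ?thesis using order_trans by blast
    qed
    have D_meas: "D \<in> borel_measurable P"
      unfolding D_def map_T
      by (intro borel_measurable_SUP countable_finite[OF H(1)] borel_measurable_ereal borel_measurable_diff
          borel_measurable_const measurable_compose[OF T map_meas])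
    have "1 - \<delta> \<le> measure (distr P ?S T) ?A" using conc unfolding law .
    also have "\<dots> = measure P (T -` ?A \<inter> space P)"
      using \<Phi>_meas by (intro measure_distr T) (auto simp: law[symmetric])
    also have "\<dots> \<le> measure P {\<omega> \<in> space P. D \<omega> \<le> R}"
    proof (rule P.finite_measure_mono)
      show "{\<omega> \<in> space P. D \<omega> \<le> R} \<in> sets P"
        using D_meas by measurable
      show "T -` ?A \<inter> space P \<subseteq> {\<omega> \<in> space P. D \<omega> \<le> R}"
      proof (intro subsetI CollectI conjI)
        fix \<omega> assume \<omega>: "\<omega> \<in> T -` ?A \<inter> space P"
        then show "\<omega> \<in> space P" by simp
        have le: "\<Phi> (T \<omega>) \<le> (\<integral>x. \<Phi> x \<partial>?Q) + \<epsilon>" using \<omega> by simp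
        show "D \<omega> \<le> R"
          unfolding D_def map_T
        proof (rule SUP_least)
          fix h assume "h \<in> H"
          then have "E' h - f (map_vec n h (T \<omega>)) \<le> \<Phi> (T \<omega>)"
            unfolding \<Phi>_def by (rule finite_SUP_upper[OF H(1)])
          then have "ereal (E' h - f (map_vec n h (T \<omega>))) \<le> ereal ((\<integral>x. \<Phi> x \<partial>?Q) + \<epsilon>)"
            using le by simp
          then show "ereal (E' h - f (map_vec n h (T \<omega>))) \<le> R"
            using R_bound by (rule order_trans)
        qed
      qed
    qed
    finally show ?thesis unfolding D_def E'_def R_def .
  qed
qed

end
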